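(* Let $d\geq2$ and $0\leq q\leq d-2$. Let $\hat V_q$ be any local algorithm for the intrinsic volume $V_q$ (as defined in the context, for any $n\in\mathbb N$ and any lattice $\mathbb L\subseteq\mathbb R^d$) for which $\lim_{a\to0}E\hat V_q^{a\mathbb L_c}(P)$ exists for all $P\in\mathcal P^d$. Then $\hat V_q$ has an asymptotic worst case (relative) bias of at least $100\%$ on $\mathcal P^d$, i.e. $$\sup_{P\in\mathcal P^d}\frac{\left|\lim_{a\to0}E\hat V_q^{a\mathbb L_c}(P)-V_q(P)\right|}{V_q(P)}\geq1.$$
   Context: Lattice and configurations: $\xi=\{\xi_1,\dots,\xi_d\}$ is a positively oriented basis of $\mathbb R^d$, $\mathbb L$ is the lattice it spans, $C_\xi=\bigoplus_{i=1}^d[0,\xi_i]$ is its unit cell, and $\mathbb L_c=\mathbb L+c$ for $c\in\mathbb R^d$. For $n\in\mathbb N$ let $C^n_{0,0}=\{\sum_i\lambda_i\xi_i:\lambda_i\in\{0,\dots,n-1\}\}$. An $n\times\dots\times n$ configuration is a pair $(B,W)$ of disjoint sets with $B\cup W=C^n_{0,0}$; these are enumerated as $(B_l,W_l)$, $l=0,\dots,2^{n^d}-1$, with $B_0=\emptyset$ and $B_{2^{n^d}-1}=C^n_{0,0}$. Local algorithm for $V_q$: functions $w_l:(0,\infty)\to\mathbb R$ (weights), $l=1,\dots,2^{n^d}-1$, giving for compact $X\subseteq\mathbb R^d$, $a>0$, $c\in C_\xi$ the estimator $\hat V_q^{a\mathbb L_c}(X)=\sum_{l=1}^{2^{n^d}-1}w_l(a)N_l(X\cap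 a\mathbb L_c)$, where $N_l(X\cap a\mathbb L_c)$ is the number of $z\in\mathbb L$ with $a(z+c)+aB_l\subseteq X$ and $a(z+c)+aW_l\subseteq\mathbb R^d\setminus X$. The weights are motion and reflection invariant: $w_{l_1}=w_{l_2}$ whenever there are a rotation or reflection $R$ preserving $\mathbb L$ and $z_1,z_2\in\mathbb R^d$ with $R(B_{l_1}+z_1)=B_{l_2}+z_2$. $V_q$ is the $q$-th intrinsic volume, given for compact convex $X$ by the Steiner formula $\mathcal H^d(X\oplus B(r))=\sum_{q=0}^d r^{d-q}\kappa_{d-q}V_q(X)$, with $B(r)$ the ball of radius $r$ and $\kappa_j$ the volume of the unit ball in $\mathbb R^j$. $\mathcal P^d$ is the set of compact convex polytopes in $\mathbb R^d$ with non-empty interior. $E$ denotes the mean when $c$ is uniformly distributed in $C_\xi$. *)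

theory Defs
  imports "HOL-Analysis.Analysis"
begin

text \<open>The ambient space is \<open>real ^ 'd\<close>, so \<open>d = CARD('d)\<close>, and a basis is a family
  \<open>\<xi> :: 'd \<Rightarrow> real ^ 'd\<close>. The sign of \<open>det (\<chi> i. \<xi> i)\<close> does not depend on how the index type
  is ordered, because basis vectors and coordinates carry the same index.\<close>

definition positively_oriented_basis :: "('d::finite \<Rightarrow> real ^ 'd) \<Rightarrow> bool" where
  "positively_oriented_basis \<xi> \<longleftrightarrow>
     inj \<xi> \<and> independent (range \<xi>) \<and> span (range \<xi>) = UNIV \<and> 0 < det (\<chi> i. \<xi> i)"

definition lattice_of :: "('d::finite \<Rightarrow> real ^ 'd) \<Rightarrow> (real ^ 'd) set" where
  "lattice_of \<xi> = {\<Sum>i\<in>UNIV. real_of_int (m i) *\<^sub>R \<xi> i |m. True}"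

definition unit_cell :: "('d::finite \<Rightarrow> real ^ 'd) \<Rightarrow> (real ^ 'd) set" where
  "unit_cell \<xi> = {\<Sum>i\<in>UNIV. t i *\<^sub>R \<xi> i |t. \<forall>i. t i \<in> {0..1}}"

definition cell_points :: "('d::finite \<Rightarrow> real ^ 'd) \<Rightarrow> nat \<Rightarrow> (real ^ 'd) set" where
  "cell_points \<xi> n = {\<Sum>i\<in>UNIV. real (k i) *\<^sub>R \<xi> i |k. \<forall>i. k i < n}"

type_synonym 'd configuration = "(real ^ 'd) set \<times> (real ^ 'd) set"

definition configurations :: "('d::finite \<Rightarrow> real ^ 'd) \<Rightarrow> nat \<Rightarrow> 'd configuration set" where
  "configurations \<xi> n = {(B, W). B \<inter> W = {} \<and> B \<union> W = cell_points \<xi> n}"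

definition configuration_enumeration ::
  "('d::finite \<Rightarrow> real ^ 'd) \<Rightarrow> nat \<Rightarrow> (nat \<Rightarrow> 'd configuration) \<Rightarrow> bool" where
  "configuration_enumeration \<xi> n conf \<longleftrightarrow>
     bij_betw conf {0..<2 ^ (n ^ CARD('d))} (configurations \<xi> n) \<and>
     fst (conf 0) = {} \<and>
     fst (conf (2 ^ (n ^ CARD('d)) - 1)) = cell_points \<xi> n"

text \<open>For compact \<open>X\<close>, \<open>a > 0\<close> and \<open>B \<noteq> {}\<close> the set below is finite, so \<open>card\<close> is the
  true number of occurrences.\<close>

definition configuration_count ::
  "('d::finite \<Rightarrow> real ^ 'd) \<Rightarrow> 'd configuration \<Rightarrow> real \<Rightarrow> real ^ 'd \<Rightarrow> (real ^ 'd) set \<Rightarrow> nat" where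
  "configuration_count \<xi> BW a c X =
     card {z \<in> lattice_of \<xi>.
             (\<lambda>b. a *\<^sub>R (z + c) + a *\<^sub>R b) ` fst BW \<subseteq> X \<and>
             (\<lambda>w. a *\<^sub>R (z + c) + a *\<^sub>R w) ` snd BW \<subseteq> UNIV - X}"

text \<open>Weights are functions on \<open>(0,\<infinity>)\<close>; their values at \<open>a \<le> 0\<close> are irrelevant. The
  rotations and reflections fixing the origin are the orthogonal maps of determinant
  \<open>1\<close> and \<open>-1\<close> respectively.\<close>

definition motion_reflection_invariant ::
  "('d::finite \<Rightarrow> real ^ 'd) \<Rightarrow> nat \<Rightarrow> (nat \<Rightarrow> 'd configuration) \<Rightarrow> (nat \<Rightarrow> real \<Rightarrow> real) \<Rightarrow> bool" where
  "motion_reflection_invariant \<xi> n conf w \<longleftrightarrow>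
     (\<forall>l1 \<in> {1..2 ^ (n ^ CARD('d)) - 1}. \<forall>l2 \<in> {1..2 ^ (n ^ CARD('d)) - 1}.
        (\<exists>R z1 z2. orthogonal_transformation R \<and> R ` lattice_of \<xi> = lattice_of \<xi> \<and>
           R ` ((\<lambda>b. b + z1) ` fst (conf l1)) = (\<lambda>b. b + z2) ` fst (conf l2)) \<longrightarrow>
        (\<forall>a>0. w l1 a = w l2 a))"

definition local_estimator ::
  "('d::finite \<Rightarrow> real ^ 'd) \<Rightarrow> nat \<Rightarrow> (nat \<Rightarrow> 'd configuration) \<Rightarrow> (nat \<Rightarrow> real \<Rightarrow> real) \<Rightarrow>
   real \<Rightarrow> real ^ 'd \<Rightarrow> (real ^ 'd) set \<Rightarrow> real" where
  "local_estimator \<xi> n conf w a c X =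
     (\<Sum>l = 1..2 ^ (n ^ CARD('d)) - 1. w l a * real (configuration_count \<xi> (conf l) a c X))"

definition mean_estimator ::
  "('d::finite \<Rightarrow> real ^ 'd) \<Rightarrow> nat \<Rightarrow> (nat \<Rightarrow> 'd configuration) \<Rightarrow> (nat \<Rightarrow> real \<Rightarrow> real) \<Rightarrow>
   real \<Rightarrow> (real ^ 'd) set \<Rightarrow> real" where
  "mean_estimator \<xi> n conf w a X =
     (LINT c|uniform_measure lborel (unit_cell \<xi>). local_estimator \<xi> n conf w a c X)"

text \<open>The Steiner formula determines the coefficients \<open>V 0, \<dots>, V d\<close> uniquely, so for compact
  convex \<open>X\<close> and \<open>q \<le> d\<close> the description below denotes the \<open>q\<close>-th intrinsic volume;
  \<open>unit_ball_vol (real j)\<close> is the volume of the unit ball in dimension \<open>j\<close>.\<close>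

definition steiner_formula :: "(real ^ 'd::finite) set \<Rightarrow> (nat \<Rightarrow> real) \<Rightarrow> bool" where
  "steiner_formula X V \<longleftrightarrow>
     (\<forall>r\<ge>0. measure lebesgue {x + y |x y. x \<in> X \<and> y \<in> cball 0 r} =
        (\<Sum>q = 0..CARD('d). r ^ (CARD('d) - q) * unit_ball_vol (real (CARD('d) - q)) * V q))"

definition intrinsic_volume :: "nat \<Rightarrow> (real ^ 'd::finite) set \<Rightarrow> real" where
  "intrinsic_volume q X = (THE v. \<exists>V. steiner_formula X V \<and> V q = v)"

definition full_polytopes :: "(real ^ 'd::finite) set set" where
  "full_polytopes = {P. polytope P \<and> interior P \<noteq> {}}"

end

theory Submission
  imports Defs
begin

text \<open>
  Suppose that the relative bias stays below \<open>1\<close>. Then on every full-dimensional polytope the limit of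
  the mean estimator lies strictly between \<open>0\<close> and twice the intrinsic volume. Testing this on
  parallelotopes is enough for a contradiction.

  A parallelotope \<open>P\<close> is given by linearly independent normals \<open>u i\<close> and slab lengths \<open>H i\<close>. The points
  at which a translate of \<open>a T\<close> fits into \<open>P\<close> form a parallelotope whose slab lengths are shortened by
  \<open>a\<close> times the width of \<open>T\<close> in the directions \<open>u i\<close>. So for small \<open>a\<close> the mean estimator is, up to the
  volume factor \<open>1 / \<bar>det u\<bar>\<close>, a combination of products of the numbers \<open>H i / a - width T (u i)\<close>
  (\<open>mean_estimator_parallelotope\<close>), hence a multi-affine polynomial in \<open>H\<close>. The intrinsic volume is a
  multi-affine polynomial in \<open>H\<close> as well, with positive coefficients exactly at the \<open>q\<close>-element sets
  \<open>I\<close> (\<open>parallelotope_intrinsic_volume\<close>, \<open>zonotope_coeff_pos\<close>).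

  A multi-affine polynomial that is nonnegative for positive arguments has nonnegative coefficients
  (\<open>multiaffine_nonneg_coeffs\<close>). Hence the inequality between the two polynomials descends to
  coefficients: in the limit, those of the estimator vanish at all sets \<open>I\<close> with \<open>card I \<noteq> q\<close> and are
  bounded by twice those of the intrinsic volume if \<open>card I = q\<close>.

  The coefficient at \<open>I\<close> is built from products of widths in the \<open>d - q \<ge> 2\<close> directions \<open>u i\<close> with
  \<open>i \<notin> I\<close>. Widths of finitely many finite sets are linear on an open cone of directions
  (\<open>width_cone_exists\<close>), so on this cone the coefficient is a symmetric multilinear form times
  \<open>1 / \<bar>det u\<bar>\<close>. Let two of the directions outside \<open>I\<close> become parallel. The volume factor explodes,
  but the coefficient of the intrinsic volume at \<open>I\<close> does not change, as it depends only on the edges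
  with index in \<open>I\<close> (\<open>zonotope_coeff_local\<close>). Therefore the form vanishes whenever two arguments
  agree (\<open>coefficient_diagonal\<close>), and being symmetric it vanishes identically
  (\<open>coefficient_vanishes\<close>). So the estimator tends to \<open>0\<close> on some parallelotope, where its limit should
  be positive.
\<close>

section \<open>Multi-affine functions on the positive orthant\<close>

lemma sum_Pow_insert:
  fixes g :: "'i set \<Rightarrow> 'b::comm_monoid_add"
  assumes "finite F" "j \<notin> F"
  shows "(\<Sum>I\<in>Pow (insert j F). g I) = (\<Sum>I\<in>Pow F. g I) + (\<Sum>I\<in>Pow F. g (insert j I))"
proof -
  have inj: "inj_on (insert j) (Pow F)"
    using assms by (auto simp: inj_on_def)
  have "Pow F \<inter> insert j ` Pow F = {}"
    using assms by auto
  then show ?thesis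
    using assms by (simp add: Pow_insert sum.union_disjoint sum.reindex[OF inj])
qed

lemma multiaffine_split:
  fixes c :: "'i set \<Rightarrow> real" and H :: "'i \<Rightarrow> real"
  assumes "finite F" "j \<notin> F"
  shows "(\<Sum>I\<in>Pow (insert j F). c I * (\<Prod>i\<in>I. (H(j := x)) i)) =
    (\<Sum>I\<in>Pow F. c I * (\<Prod>i\<in>I. H i)) + x * (\<Sum>I\<in>Pow F. c (insert j I) * (\<Prod>i\<in>I. H i))"
proof -
  have *: "(\<Prod>i\<in>I. (H(j := x)) i) = (\<Prod>i\<in>I. H i)" if "I \<in> Pow F" for I
    using that assms by (intro prod.cong) auto
  have "(\<Prod>i\<in>insert j I. (H(j := x)) i) = x * (\<Prod>i\<in>I. H i)" if "I \<in> Pow F" for I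
  proof -
    have "finite I" "j \<notin> I"
      using that assms finite_subset by auto
    then show ?thesis
      using *[OF that] by simp
  qed
  with * show ?thesis
    by (simp add: sum_Pow_insert[OF assms] sum_distrib_left mult.left_commute)
qed

lemma affine_nonneg_coeffs:
  fixes p q :: real
  assumes "\<And>x. 0 < x \<Longrightarrow> 0 \<le> p + x * q"
  shows "0 \<le> p" "0 \<le> q"
proof -
  show "0 \<le> p"
  proof (rule ccontr)
    assume "\<not> 0 \<le> p"
    then have "p + (- p / (2 * (\<bar>q\<bar> + 1))) * q < 0"
      by (simp add: field_simps) (smt (verit) mult_less_cancel_left_neg mult_minus_right)
    moreover have "0 < - p / (2 * (\<bar>q\<bar> + 1))"
      using \<open>\<not> 0 \<le> p\<close> by (simp add: field_simps)
    ultimately show False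
      using assms[of "- p / (2 * (\<bar>q\<bar> + 1))"] by simp
  qed
  show "0 \<le> q"
  proof (rule ccontr)
    assume "\<not> 0 \<le> q"
    then have "((\<bar>p\<bar> + 1) / (- q)) * q = - (\<bar>p\<bar> + 1)"
      by simp
    then have "p + ((\<bar>p\<bar> + 1) / (- q)) * q < 0"
      by linarith
    moreover have "0 < (\<bar>p\<bar> + 1) / (- q)"
      using \<open>\<not> 0 \<le> q\<close> by (intro divide_pos_pos) auto
    ultimately show False
      using assms[of "(\<bar>p\<bar> + 1) / (- q)"] by simp
  qed
qed

text \<open>Letting one variable tend to \<open>0\<close> and to \<open>\<infinity>\<close> isolates the parts of the polynomial without and with
  that variable; induction on the variables then isolates each single coefficient. Every coefficient
  is reached because the exponent vectors are the vertices of a cube. Applied to differences, the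
  lemma turns any inequality between multi-affine polynomials into inequalities between
  corresponding coefficients.\<close>

lemma multiaffine_nonneg_coeffs:
  fixes c :: "'i set \<Rightarrow> real"
  assumes "finite F"
    and "\<And>H. (\<And>i. 0 < H i) \<Longrightarrow> 0 \<le> (\<Sum>I\<in>Pow F. c I * (\<Prod>i\<in>I. H i))"
    and "I \<subseteq> F"
  shows "0 \<le> c I"
  using assms
proof (induction F arbitrary: c I rule: finite_induct)
  case empty
  then show ?case using empty(1)[of "\<lambda>_. 1"] by simp
next
  case (insert j F)
  have aff: "0 \<le> (\<Sum>I\<in>Pow F. c I * (\<Prod>i\<in>I. H i)) + x * (\<Sum>I\<in>Pow F. c (insert j I) * (\<Prod>i\<in>I. H i))"
    if "\<And>i. 0 < H i" "0 < x" for H x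
    using insert.prems(1)[of "H(j := x)"] that
    by (simp only: multiaffine_split[OF insert.hyps(1,2)]) (simp add: fun_upd_def)
  show ?case
  proof (cases "j \<in> I")
    case True
    have "0 \<le> c (insert j (I - {j}))"
    proof (rule insert.IH[where c = "\<lambda>I. c (insert j I)" and I = "I - {j}"])
      show "0 \<le> (\<Sum>I\<in>Pow F. c (insert j I) * (\<Prod>i\<in>I. H i))" if "\<And>i. 0 < H i" for H
        using affine_nonneg_coeffs(2)[of "\<Sum>I\<in>Pow F. c I * (\<Prod>i\<in>I. H i)"] aff[of H] that by blast
    qed (use insert.prems(2) in auto)
    with True show ?thesis by (simp add: insert_absorb)
  next
    case False
    show ?thesis
    proof (rule insert.IH[where c = c and I = I])
      show "0 \<le> (\<Sum>I\<in>Pow F. c I * (\<Prod>i\<in>I. H i))" if "\<And>i. 0 < H i" for H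
        using affine_nonneg_coeffs(1)[of "\<Sum>I\<in>Pow F. c I * (\<Prod>i\<in>I. H i)"] aff[of H] that by blast
    qed (use insert.prems(2) False in auto)
  qed
qed

text \<open>The values at \<open>H j = 1\<close> and \<open>H j = 2\<close> determine the parts without and with \<open>H j\<close> as fixed linear
  combinations, so convergence passes to both parts, and by induction to each coefficient.\<close>

lemma multiaffine_tendsto_coeffs:
  fixes A :: "'a \<Rightarrow> 'i set \<Rightarrow> real"
  assumes "finite F"
    and "\<And>H. (\<And>i. 0 < H i) \<Longrightarrow> \<exists>l. ((\<lambda>a. \<Sum>I\<in>Pow F. A a I * (\<Prod>i\<in>I. H i)) \<longlongrightarrow> l) net"
    and "I \<subseteq> F"
  shows "\<exists>l. ((\<lambda>a. A a I) \<longlongrightarrow> l) net"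
  using assms
proof (induction F arbitrary: A I rule: finite_induct)
  case empty
  then show ?case using empty(1)[of "\<lambda>_. 1"] by simp
next
  case (insert j F)
  have low: "\<exists>l. ((\<lambda>a. \<Sum>I\<in>Pow F. A a I * (\<Prod>i\<in>I. H i)) \<longlongrightarrow> l) net" (is "\<exists>l. (?L \<longlongrightarrow> l) net")
    and high: "\<exists>l. ((\<lambda>a. \<Sum>I\<in>Pow F. A a (insert j I) * (\<Prod>i\<in>I. H i)) \<longlongrightarrow> l) net" (is "\<exists>l. (?H \<longlongrightarrow> l) net")
    if H: "\<And>i. 0 < H i" for H
  proof -
    have conv: "\<exists>l. ((\<lambda>a. ?L a + x * ?H a) \<longlongrightarrow> l) net" if "0 < x" for x
      using insert.prems(1)[of "H(j := x)"] H that
      by (simp only: multiaffine_split[OF insert.hyps(1,2)]) (simp add: fun_upd_def)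
    obtain l1 l2 where l: "((\<lambda>a. ?L a + 1 * ?H a) \<longlongrightarrow> l1) net" "((\<lambda>a. ?L a + 2 * ?H a) \<longlongrightarrow> l2) net"
      using conv[of 1] conv[of 2] by auto
    show "\<exists>l. (?H \<longlongrightarrow> l) net"
      using tendsto_diff[OF l(2,1)] by (auto simp: algebra_simps)
    have "(\<lambda>a. 2 * (?L a + 1 * ?H a) - (?L a + 2 * ?H a)) = ?L"
      by (auto simp: algebra_simps)
    with tendsto_diff[OF tendsto_mult_left[OF l(1), of 2] l(2)] show "\<exists>l. (?L \<longlongrightarrow> l) net"
      by auto
  qed
  show ?case
  proof (cases "j \<in> I")
    case True
    have "\<exists>l. ((\<lambda>a. A a (insert j (I - {j}))) \<longlongrightarrow> l) net"
      by (rule insert.IH[where A = "\<lambda>a I. A a (insert j I)" and I = "I - {j}"]) (use insert.prems(2) high in auto)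
    with True show ?thesis by (simp add: insert_absorb)
  next
    case False
    with insert.prems(2) show ?thesis
      by (intro insert.IH[OF low]) auto
  qed
qed

text \<open>The hypothesis says that \<open>G\<close> is affine in each variable of \<open>F\<close> separately. Arguments vanish outside
  \<open>F\<close> so that the induction can peel off one variable at a time without carrying parameters along.\<close>

lemma multiaffine_expansion:
  fixes G :: "('i \<Rightarrow> real) \<Rightarrow> real"
  assumes "finite F"
    and "\<And>s j. (\<And>i. 0 \<le> s i) \<Longrightarrow> j \<in> F \<Longrightarrow> G s = G (s(j := 0)) + s j * (G (s(j := 1)) - G (s(j := 0)))"
  shows "\<exists>c. \<forall>s. (\<forall>i. 0 \<le> s i) \<and> (\<forall>i. i \<notin> F \<longrightarrow> s i = 0) \<longrightarrow> G s = (\<Sum>I\<in>Pow F. c I * (\<Prod>i\<in>I. s i))"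
  using assms
proof (induction F arbitrary: G rule: finite_induct)
  case empty
  have "s = (\<lambda>_. 0)" if "\<forall>i. s i = 0" for s :: "'i \<Rightarrow> real"
    using that by auto
  then show ?case by (intro exI[of _ "\<lambda>_. G (\<lambda>_. 0)"]) auto
next
  case (insert j F)
  define G0 where "G0 s = G (s(j := 0))" for s
  define G1 where "G1 s = G (s(j := 1)) - G (s(j := 0))" for s
  have upd: "G (s(j := x)) = G (s(k := 0, j := x)) + s k * (G (s(k := 1, j := x)) - G (s(k := 0, j := x)))"
    if "\<And>i. 0 \<le> s i" "k \<in> F" "0 \<le> x" for s k x
  proof -
    have "k \<noteq> j" using that insert.hyps by auto
    then have "s(k := y, j := x) = s(j := x, k := y)" "(s(j := x)) k = s k" for y
      by auto
    then show ?thesis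
      using insert.prems[of "s(j := x)" k] that by fastforce
  qed
  have "G0 s = G0 (s(k := 0)) + s k * (G0 (s(k := 1)) - G0 (s(k := 0)))"
    if "\<And>i. 0 \<le> s i" "k \<in> F" for s k
    using upd[of s k 0] that unfolding G0_def by simp
  from insert.IH[of G0, OF this] obtain c0 where c0: "\<And>s. (\<forall>i. 0 \<le> s i) \<and> (\<forall>i. i \<notin> F \<longrightarrow> s i = 0) \<Longrightarrow> G0 s = (\<Sum>I\<in>Pow F. c0 I * (\<Prod>i\<in>I. s i))"
    by blast
  have "G1 s = G1 (s(k := 0)) + s k * (G1 (s(k := 1)) - G1 (s(k := 0)))"
    if "\<And>i. 0 \<le> s i" "k \<in> F" for s k
    using upd[of s k 0] upd[of s k 1] that unfolding G1_def by (simp add: algebra_simps)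
  from insert.IH[of G1, OF this] obtain c1 where c1: "\<And>s. (\<forall>i. 0 \<le> s i) \<and> (\<forall>i. i \<notin> F \<longrightarrow> s i = 0) \<Longrightarrow> G1 s = (\<Sum>I\<in>Pow F. c1 I * (\<Prod>i\<in>I. s i))"
    by blast
  define c where "c I = (if j \<in> I then c1 (I - {j}) else c0 I)" for I
  have "G s = (\<Sum>I\<in>Pow (insert j F). c I * (\<Prod>i\<in>I. s i))"
    if s: "\<forall>i. 0 \<le> s i" "\<forall>i. i \<notin> insert j F \<longrightarrow> s i = 0" for s
  proof -
    let ?s = "s(j := 0)"
    have c0': "(\<Sum>I\<in>Pow F. c I * (\<Prod>i\<in>I. ?s i)) = G0 ?s"
    proof -
      have "c I = c0 I" if "I \<in> Pow F" for I
        using that insert.hyps by (auto simp: c_def)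
      then show ?thesis using c0[of ?s] s by simp
    qed
    have c1': "(\<Sum>I\<in>Pow F. c (insert j I) * (\<Prod>i\<in>I. ?s i)) = G1 ?s"
    proof -
      have "c (insert j I) = c1 I" if "I \<in> Pow F" for I
      proof -
        have "j \<notin> I" using that insert.hyps by auto
        then show ?thesis by (simp add: c_def)
      qed
      then show ?thesis using c1[of ?s] s by simp
    qed
    have "G s = G0 ?s + s j * G1 ?s"
      unfolding G0_def G1_def fun_upd_upd by (rule insert.prems) (use s in auto)
    also have "\<dots> = (\<Sum>I\<in>Pow (insert j F). c I * (\<Prod>i\<in>I. (?s(j := s j)) i))"
      unfolding multiaffine_split[OF insert.hyps(1,2)] c0' c1' ..
    finally show ?thesis by simp
  qed
  then show ?case by blast
qed

text \<open>Cauchy's functional equation on the half-line: additivity gives linearity at multiples, and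
  nonnegativity makes the function monotone, which squeezes the remaining values.\<close>

lemma nonneg_additive_imp_linear:
  fixes \<psi> :: "real \<Rightarrow> real"
  assumes nonneg: "\<And>t. 0 \<le> t \<Longrightarrow> 0 \<le> \<psi> t"
    and add: "\<And>s t. 0 \<le> s \<Longrightarrow> 0 \<le> t \<Longrightarrow> \<psi> (s + t) = \<psi> s + \<psi> t"
    and t: "0 \<le> t"
  shows "\<psi> t = t * \<psi> 1"
proof -
  have mono: "\<psi> s \<le> \<psi> t" if "0 \<le> s" "s \<le> t" for s t
    using add[of s "t - s"] nonneg[of "t - s"] that by simp
  have zero: "\<psi> 0 = 0"
    using add[of 0 0] by simp
  have mult: "\<psi> (real m * s) = real m * \<psi> s" if "0 \<le> s" for m s
  proof (induction m)
    case (Suc m)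
    then show ?case
      using add[of "real m * s" s] that by (simp add: algebra_simps)
  qed (simp add: zero)
  have bound: "\<bar>\<psi> t - t * \<psi> 1\<bar> * real k \<le> \<psi> 1" for k
  proof -
    define m where "m = nat \<lfloor>real k * t\<rfloor>"
    have m: "real m \<le> real k * t" "real k * t \<le> real (Suc m)"
      using t by (auto simp: m_def) linarith+
    have "real m * \<psi> 1 \<le> real k * \<psi> t"
      using mono[OF _ m(1)] mult[of 1 m] mult[OF t, of k] by simp
    moreover have "real k * \<psi> t \<le> (real m + 1) * \<psi> 1"
      using mono[OF _ m(2)] mult[of 1 "Suc m"] mult[OF t, of k] t by (simp add: add.commute)
    moreover have "real m * \<psi> 1 \<le> real k * t * \<psi> 1" "real k * t * \<psi> 1 \<le> (real m + 1) * \<psi> 1"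
      using m nonneg[of 1] by (auto intro!: mult_right_mono simp: add.commute)
    ultimately have "\<bar>real k * \<psi> t - real k * t * \<psi> 1\<bar> \<le> \<psi> 1"
      by (simp add: algebra_simps)
    moreover have "\<bar>\<psi> t - t * \<psi> 1\<bar> * real k = \<bar>real k * \<psi> t - real k * t * \<psi> 1\<bar>"
    proof -
      have "real k * \<psi> t - real k * t * \<psi> 1 = (\<psi> t - t * \<psi> 1) * real k"
        by (simp add: algebra_simps)
      then show ?thesis by (simp add: abs_mult)
    qed
    ultimately show ?thesis by simp
  qed
  show ?thesis
  proof (rule ccontr)
    assume "\<psi> t \<noteq> t * \<psi> 1"
    then obtain k where "\<psi> 1 < real k * \<bar>\<psi> t - t * \<psi> 1\<bar>"
      using reals_Archimedean3[of "\<bar>\<psi> t - t * \<psi> 1\<bar>"] by auto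
    with bound[of k] show False by (simp add: mult.commute)
  qed
qed

section \<open>Parallelotopes and zonotopes\<close>

text \<open>The facets of a parallelotope are described by normals \<open>u\<close>, its edges by the dual basis \<open>e\<close>. The
  inclusion conditions for translates of finite sets are simple in terms of \<open>u\<close>, Minkowski sums
  with balls in terms of \<open>e\<close>.\<close>

definition dual_families :: "('d::finite \<Rightarrow> real ^ 'd) \<Rightarrow> ('d \<Rightarrow> real ^ 'd) \<Rightarrow> bool" where
  "dual_families u e \<longleftrightarrow> (\<forall>i j. u i \<bullet> e j = (if i = j then 1 else 0))"

definition parallelotope :: "('d::finite \<Rightarrow> real ^ 'd) \<Rightarrow> ('d \<Rightarrow> real) \<Rightarrow> (real ^ 'd) set" where
  "parallelotope u H = {x. \<forall>i. 0 \<le> u i \<bullet> x \<and> u i \<bullet> x \<le> H i}"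

definition zonotope :: "('d::finite \<Rightarrow> real ^ 'd) \<Rightarrow> ('d \<Rightarrow> real) \<Rightarrow> (real ^ 'd) set" where
  "zonotope e s = {\<Sum>i\<in>UNIV. t i *\<^sub>R e i |t. \<forall>i. 0 \<le> t i \<and> t i \<le> s i}"

lemma dual_families_exist:
  fixes u :: "'d::finite \<Rightarrow> real ^ 'd"
  assumes "det (\<chi> i. u i) \<noteq> 0"
  obtains e where "dual_families u e"
proof -
  obtain B where B: "(\<chi> i. u i) ** B = mat 1"
    using assms invertible_det_nz invertible_right_inverse by blast
  have "u i \<bullet> column j B = (if i = j then 1 else 0)" for i j
  proof -
    have "((\<chi> i. u i) ** B) $ i $ j = u i \<bullet> column j B"
      by (simp add: matrix_matrix_mult_def inner_vec_def column_def)
    then show ?thesis by (simp add: B mat_def)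
  qed
  then show ?thesis
    using that[of "\<lambda>j. column j B"] by (simp add: dual_families_def)
qed

lemma dual_families_inner_sum:
  assumes "dual_families u e"
  shows "u i \<bullet> (\<Sum>j\<in>UNIV. t j *\<^sub>R e j) = t i"
proof -
  have "u i \<bullet> (\<Sum>j\<in>UNIV. t j *\<^sub>R e j) = (\<Sum>j\<in>UNIV. if i = j then t j else 0)"
    using assms unfolding dual_families_def inner_sum_right by (intro sum.cong) auto
  then show ?thesis by simp
qed

lemma dual_families_expansion:
  fixes u e :: "'d::finite \<Rightarrow> real ^ 'd"
  assumes "dual_families u e"
  shows "(\<Sum>i\<in>UNIV. (u i \<bullet> x) *\<^sub>R e i) = x"
proof -
  have "(\<chi> i. u i) ** transpose (\<chi> j. e j) = mat 1"
    using assms by (simp add: dual_families_def matrix_matrix_mult_def transpose_def mat_def inner_vec_def vec_eq_iff)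
  then have "transpose (\<chi> j. e j) ** (\<chi> i. u i) = mat 1"
    using matrix_left_right_inverse by blast
  then have "transpose (\<chi> j. e j) *v ((\<chi> i. u i) *v x) = x"
    by (simp add: matrix_vector_mul_assoc)
  moreover have "transpose (\<chi> j. e j) *v ((\<chi> i. u i) *v x) = (\<Sum>i\<in>UNIV. (u i \<bullet> x) *\<^sub>R e i)"
    by (simp add: vec_eq_iff matrix_vector_mult_def transpose_def inner_vec_def mult.commute)
  ultimately show ?thesis by simp
qed

lemma slab_eq_image:
  assumes "dual_families u e"
  shows "{x. \<forall>i. \<alpha> i \<le> u i \<bullet> x \<and> u i \<bullet> x \<le> \<beta> i} =
    (\<lambda>v. transpose (\<chi> j. e j) *v v) ` cbox (\<chi> i. \<alpha> i) (\<chi> i. \<beta> i)" (is "?S = ?f ` ?C")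
proof -
  have f: "?f v = (\<Sum>i\<in>UNIV. v $ i *\<^sub>R e i)" for v
    by (simp add: vec_eq_iff matrix_vector_mult_def transpose_def mult.commute)
  show ?thesis
  proof (intro set_eqI iffI)
    fix x assume "x \<in> ?S"
    then have "(\<chi> i. u i \<bullet> x) \<in> ?C"
      by (simp add: mem_box_cart)
    moreover have "x = ?f (\<chi> i. u i \<bullet> x)"
      unfolding f using dual_families_expansion[OF assms] by simp
    ultimately show "x \<in> ?f ` ?C"
      by blast
  next
    fix x assume "x \<in> ?f ` ?C"
    then show "x \<in> ?S"
      unfolding f by (auto simp: mem_box_cart dual_families_inner_sum[OF assms])
  qed
qed

lemma slab_compact:
  assumes "dual_families u e"
  shows "compact {x. \<forall>i. \<alpha> i \<le> u i \<bullet> x \<and> u i \<bullet> x \<le> \<beta> i}"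
  unfolding slab_eq_image[OF assms]
  by (intro compact_continuous_image linear_continuous_on) (auto simp: linear_linear)

lemma parallelotope_eq_zonotope:
  assumes "dual_families u e"
  shows "parallelotope u H = zonotope e H"
proof (intro set_eqI iffI)
  fix x assume "x \<in> parallelotope u H"
  then show "x \<in> zonotope e H"
    using dual_families_expansion[OF assms, of x]
    unfolding parallelotope_def zonotope_def by (intro CollectI exI[of _ "\<lambda>i. u i \<bullet> x"]) auto
next
  fix x assume "x \<in> zonotope e H"
  then show "x \<in> parallelotope u H"
    by (auto simp: parallelotope_def zonotope_def dual_families_inner_sum[OF assms])
qed


lemma parallelotope_full:
  fixes u :: "'d::finite \<Rightarrow> real ^ 'd"
  assumes dual: "dual_families u e" and H: "\<And>i. 0 < H i"
  shows "parallelotope u H \<in> full_polytopes"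
proof -
  have eq: "parallelotope u H = (\<lambda>v. transpose (\<chi> j. e j) *v v) ` cbox 0 (\<chi> i. H i)"
    unfolding parallelotope_def using slab_eq_image[OF dual, of "\<lambda>_. 0" H] by (simp add: zero_vec_def)
  have "polytope (parallelotope u H)"
    unfolding eq by (intro polytope_linear_image polytope_interval) simp
  moreover have "(\<Sum>i\<in>UNIV. (H i / 2) *\<^sub>R e i) \<in> interior (parallelotope u H)"
  proof (rule interiorI)
    have eq: "{x. \<forall>i. 0 < u i \<bullet> x \<and> u i \<bullet> x < H i} = (\<Inter>i. {x. 0 < u i \<bullet> x} \<inter> {x. u i \<bullet> x < H i})"
      by auto
    show "open {x. \<forall>i. 0 < u i \<bullet> x \<and> u i \<bullet> x < H i}"
      unfolding eq by (intro open_INT open_Int ballI open_halfspace_lt open_halfspace_gt) auto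
    show "(\<Sum>i\<in>UNIV. (H i / 2) *\<^sub>R e i) \<in> {x. \<forall>i. 0 < u i \<bullet> x \<and> u i \<bullet> x < H i}"
      using H by (simp add: dual_families_inner_sum[OF dual])
  qed (auto simp: parallelotope_def less_imp_le)
  ultimately show ?thesis
    by (auto simp: full_polytopes_def)
qed


lemma zonotope_compact_convex:
  fixes e :: "'d::finite \<Rightarrow> real ^ 'd"
  shows "compact (zonotope e s)" "convex (zonotope e s)"
proof -
  have eq: "zonotope e s = (\<lambda>v. transpose (\<chi> j. e j) *v v) ` cbox 0 (\<chi> i. s i)"
  proof -
    have "transpose (\<chi> j. e j) *v v = (\<Sum>i\<in>UNIV. v $ i *\<^sub>R e i)" for v
      by (simp add: vec_eq_iff matrix_vector_mult_def transpose_def mult.commute)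
    moreover have "(\<chi> i. t i) \<in> cbox 0 (\<chi> i. s i) \<longleftrightarrow> (\<forall>i. 0 \<le> t i \<and> t i \<le> s i)" for t
      by (simp add: mem_box_cart)
    ultimately show ?thesis
      unfolding zonotope_def image_def
      by (intro Collect_cong) (metis (mono_tags, lifting) mem_box_cart vec_lambda_beta vec_lambda_eta zero_index sum.cong)
  qed
  show "compact (zonotope e s)"
    unfolding eq by (intro compact_continuous_image linear_continuous_on) (auto simp: linear_linear)
  show "convex (zonotope e s)"
    unfolding eq by (intro convex_linear_image convex_box) simp
qed

lemma zonotope_update:
  fixes e :: "'d::finite \<Rightarrow> real ^ 'd"
  shows "zonotope e (s(j := t)) = {y + \<tau> *\<^sub>R e j |y \<tau>. y \<in> zonotope e (s(j := 0)) \<and> 0 \<le> \<tau> \<and> \<tau> \<le> t}"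
proof -
  have split: "(\<Sum>i\<in>UNIV. r i *\<^sub>R e i) = (\<Sum>i\<in>UNIV. (r(j := 0)) i *\<^sub>R e i) + r j *\<^sub>R e j" for r
    by (simp add: sum.remove[of UNIV j])
  show ?thesis
  proof (intro set_eqI iffI)
    fix x assume "x \<in> zonotope e (s(j := t))"
    then obtain r where r: "x = (\<Sum>i\<in>UNIV. r i *\<^sub>R e i)" "\<And>i. 0 \<le> r i \<and> r i \<le> (s(j := t)) i"
      unfolding zonotope_def by auto
    have "(\<Sum>i\<in>UNIV. (r(j := 0)) i *\<^sub>R e i) \<in> zonotope e (s(j := 0))"
    proof -
      have "\<forall>i. 0 \<le> (r(j := 0)) i \<and> (r(j := 0)) i \<le> (s(j := 0)) i"
        using r(2) by (metis fun_upd_apply order_refl)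
      then show ?thesis unfolding zonotope_def by blast
    qed
    moreover have "0 \<le> r j" "r j \<le> t"
      using r(2)[of j] by auto
    ultimately show "x \<in> {y + \<tau> *\<^sub>R e j |y \<tau>. y \<in> zonotope e (s(j := 0)) \<and> 0 \<le> \<tau> \<and> \<tau> \<le> t}"
      unfolding r(1) split[of r] by blast
  next
    fix x assume "x \<in> {y + \<tau> *\<^sub>R e j |y \<tau>. y \<in> zonotope e (s(j := 0)) \<and> 0 \<le> \<tau> \<and> \<tau> \<le> t}"
    then obtain r \<tau> where r: "x = (\<Sum>i\<in>UNIV. r i *\<^sub>R e i) + \<tau> *\<^sub>R e j" "0 \<le> \<tau>" "\<tau> \<le> t"
      "\<And>i. 0 \<le> r i \<and> r i \<le> (s(j := 0)) i"
      unfolding zonotope_def by auto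
    have "r j = 0" using r(4)[of j] by simp
    then have "x = (\<Sum>i\<in>UNIV. (r(j := \<tau>)) i *\<^sub>R e i)"
      unfolding split[of "r(j := \<tau>)"] using r(1) by (simp add: fun_upd_idem)
    moreover have "0 \<le> (r(j := \<tau>)) i \<and> (r(j := \<tau>)) i \<le> (s(j := t)) i" for i
      using r(2,3) r(4)[of i] by (cases "i = j") auto
    ultimately show "x \<in> zonotope e (s(j := t))"
      unfolding zonotope_def by blast
  qed
qed

text \<open>Lengthening the segment from \<open>s\<close> to \<open>s + t\<close> adds to the Minkowski sum a translate of what
  lengthening it from \<open>0\<close> to \<open>t\<close> adds, because \<open>K\<close> meets each line parallel to \<open>e\<close> in a compact
  interval. Hence the increase of volume is additive and nonnegative in the length, so linear.\<close>

lemma measure_segment_sum: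
  fixes K :: "'a::euclidean_space set" and e :: "'a"
  assumes "compact K" "convex K"
  defines "S \<equiv> \<lambda>t. {x + \<tau> *\<^sub>R e |x \<tau>. x \<in> K \<and> 0 \<le> \<tau> \<and> \<tau> \<le> t}"
  assumes "0 \<le> t"
  shows "measure lebesgue (S t) = measure lebesgue (S 0) + t * (measure lebesgue (S 1) - measure lebesgue (S 0))"
proof -
  define \<psi> where "\<psi> t = measure lebesgue (S t) - measure lebesgue (S 0)" for t
  have S0: "S 0 = K"
  proof -
    have "S 0 = {x + \<tau> *\<^sub>R e |x \<tau>. x \<in> K \<and> \<tau> = 0}"
      unfolding S_def by (intro Collect_cong ex_cong1) auto
    then show ?thesis by auto
  qed
  have compact_S: "compact (S t)" for t
  proof -
    have "S t = (\<lambda>(x, \<tau>). x + \<tau> *\<^sub>R e) ` (K \<times> {0..t})"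
      by (force simp: S_def)
    moreover have "continuous_on (K \<times> {0..t}) (\<lambda>(x, \<tau>). x + \<tau> *\<^sub>R e)"
      unfolding split_beta by (intro continuous_intros)
    ultimately show ?thesis
      using assms(1) by (simp add: compact_continuous_image compact_Times)
  qed
  then have meas: "S t \<in> lmeasurable" for t
    by (simp add: lmeasurable_compact)
  have mono: "S s \<subseteq> S t" if "s \<le> t" for s t
    using that unfolding S_def by fastforce
  have diff: "S (s + t) - S s = (\<lambda>y. s *\<^sub>R e + y) ` (S t - S 0)" if st: "0 \<le> s" "0 \<le> t" for s t
  proof (intro set_eqI iffI)
    fix z assume z: "z \<in> S (s + t) - S s"
    then obtain x \<tau> where x: "z = x + \<tau> *\<^sub>R e" "x \<in> K" "0 \<le> \<tau>" "\<tau> \<le> s + t"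
      unfolding S_def by auto
    with z have "s < \<tau>"
      unfolding S_def by (metis (mono_tags, lifting) DiffD2 mem_Collect_eq not_le_imp_less)
    have "z = s *\<^sub>R e + (x + (\<tau> - s) *\<^sub>R e)"
      using x(1) by (simp add: algebra_simps)
    moreover have "x + (\<tau> - s) *\<^sub>R e \<in> S t"
      using x \<open>s < \<tau>\<close> unfolding S_def by (intro CollectI exI[of _ x] exI[of _ "\<tau> - s"]) auto
    moreover have "x + (\<tau> - s) *\<^sub>R e \<notin> K"
    proof
      assume "x + (\<tau> - s) *\<^sub>R e \<in> K"
      then have "(x + (\<tau> - s) *\<^sub>R e) + s *\<^sub>R e \<in> S s"
        using st unfolding S_def by (intro CollectI exI[of _ "x + (\<tau> - s) *\<^sub>R e"] exI[of _ s]) auto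
      with z \<open>z = s *\<^sub>R e + (x + (\<tau> - s) *\<^sub>R e)\<close> show False
        by (simp add: add.commute)
    qed
    ultimately show "z \<in> (\<lambda>y. s *\<^sub>R e + y) ` (S t - S 0)"
      unfolding S0 by blast
  next
    fix z assume "z \<in> (\<lambda>y. s *\<^sub>R e + y) ` (S t - S 0)"
    then obtain x \<tau> where z: "z = s *\<^sub>R e + (x + \<tau> *\<^sub>R e)" "x \<in> K" "0 \<le> \<tau>" "\<tau> \<le> t"
      and nK: "x + \<tau> *\<^sub>R e \<notin> K"
      unfolding S0 unfolding S_def by auto
    have "z = x + (s + \<tau>) *\<^sub>R e"
      using z(1) by (simp add: algebra_simps)
    then have "z \<in> S (s + t)"
      using z st unfolding S_def by (intro CollectI exI[of _ x] exI[of _ "s + \<tau>"]) auto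
    moreover have "z \<notin> S s"
    proof
      assume "z \<in> S s"
      then obtain x' \<sigma> where x': "z = x' + \<sigma> *\<^sub>R e" "x' \<in> K" "0 \<le> \<sigma>" "\<sigma> \<le> s"
        unfolding S_def by auto
      define \<rho> \<omega> where "\<rho> = s - \<sigma>" and "\<omega> = \<tau> + \<rho>"
      have \<rho>: "0 \<le> \<rho>" "x' = x + \<omega> *\<^sub>R e"
        using x' z(1) by (auto simp: \<rho>_def \<omega>_def algebra_simps)
      show False
      proof (cases "\<omega> = 0")
        case True
        then have "\<tau> = 0" using z \<rho> by (simp add: \<omega>_def)
        then show False using nK z by simp
      next
        case False
        then have sum1: "\<rho> / \<omega> + \<tau> / \<omega> = 1"
          by (simp add: \<omega>_def add_divide_distrib[symmetric] add.commute)
        \<comment> \<open>The point outside \<open>K\<close> lies on the segment from \<open>x\<close> to \<open>x'\<close>.\<close>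
        have "(\<rho> / \<omega>) *\<^sub>R x + (\<tau> / \<omega>) *\<^sub>R x' \<in> K"
          using z \<rho>(1) x'(2) sum1 by (intro convexD[OF assms(2)]) (auto simp: \<omega>_def)
        also have "(\<rho> / \<omega>) *\<^sub>R x + (\<tau> / \<omega>) *\<^sub>R x' = (\<rho> / \<omega> + \<tau> / \<omega>) *\<^sub>R x + (\<tau> / \<omega> * \<omega>) *\<^sub>R e"
          unfolding \<rho>(2) by (simp add: scaleR_add_right scaleR_add_left)
        also have "\<dots> = x + \<tau> *\<^sub>R e"
          using False unfolding sum1 by simp
        finally show False using nK by simp
      qed
    qed
    ultimately show "z \<in> S (s + t) - S s" by simp
  qed
  have "\<psi> t = t * \<psi> 1"
  proof (rule nonneg_additive_imp_linear)
    show "0 \<le> \<psi> t" if "0 \<le> t" for t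
      unfolding \<psi>_def using measure_mono_fmeasurable[OF mono[OF that]] meas by (simp add: fmeasurableD)
    show "\<psi> (s + t) = \<psi> s + \<psi> t" if "0 \<le> s" "0 \<le> t" for s t
    proof -
      have "measure lebesgue (S (s + t)) - measure lebesgue (S s) = measure lebesgue (S (s + t) - S s)"
        using that by (subst measurable_measure_Diff) (auto simp: meas fmeasurableD mono)
      also have "\<dots> = measure lebesgue (S t - S 0)"
        unfolding diff[OF that] by (rule measure_translation)
      also have "\<dots> = measure lebesgue (S t) - measure lebesgue (S 0)"
        using that by (subst measurable_measure_Diff) (auto simp: meas fmeasurableD mono)
      finally show ?thesis by (simp add: \<psi>_def)
    qed
  qed (use assms in auto)
  then show ?thesis by (simp add: \<psi>_def)
qed

text \<open>This is the reciprocal of the absolute value of the determinant with rows \<open>u i\<close>.\<close>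

definition unit_parallelotope_volume :: "('d::finite \<Rightarrow> real ^ 'd) \<Rightarrow> real" where
  "unit_parallelotope_volume u = measure lebesgue (parallelotope u (\<lambda>_. 1))"

text \<open>The volume is affine in each side length by \<open>measure_segment_sum\<close>, and it vanishes with each side
  length because the body then lies in a hyperplane. So it is linear in each side length.\<close>

lemma zonotope_measure:
  fixes u e :: "'d::finite \<Rightarrow> real ^ 'd"
  assumes dual: "dual_families u e" and s: "\<And>i. 0 \<le> s i"
  shows "measure lebesgue (zonotope e s) = (\<Prod>i\<in>UNIV. s i) * unit_parallelotope_volume u"
proof -
  let ?G = "\<lambda>s. measure lebesgue (zonotope e s)"
  have zero: "?G (s(j := 0)) = 0" for s j
  proof (rule negligible_imp_measure0, rule negligible_subset)
    have "u j \<noteq> 0"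
      using dual unfolding dual_families_def by (metis inner_zero_left zero_neq_one)
    then show "negligible {x. u j \<bullet> x = 0}"
      by (intro negligible_hyperplane) auto
    show "zonotope e (s(j := 0)) \<subseteq> {x. u j \<bullet> x = 0}"
      unfolding parallelotope_eq_zonotope[OF dual, symmetric] parallelotope_def
      by (auto split: if_splits intro: antisym)
  qed
  have pull: "?G s = s j * ?G (s(j := 1))" if "0 \<le> s j" for s j
    using measure_segment_sum[OF zonotope_compact_convex[of e "s(j := 0)"], of "s j" "e j"] that
    unfolding zonotope_update[symmetric] by (simp add: zero)
  have "?G s = (\<Prod>i\<in>F. s i) * ?G (\<lambda>i. if i \<in> F then 1 else s i)" if "finite F" for F
    using that
  proof (induction F rule: finite_induct)
    case (insert j F)
    have "(\<lambda>i. if i \<in> insert j F then 1 else s i) = (\<lambda>i. if i \<in> F then 1 else s i)(j := 1)"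
      by auto
    then show ?case
      using insert pull[of "\<lambda>i. if i \<in> F then 1 else s i" j] s by simp
  qed simp
  from this[of UNIV] show ?thesis
    by (simp add: unit_parallelotope_volume_def parallelotope_eq_zonotope[OF dual])
qed

lemma slab_measure:
  fixes u e :: "'d::finite \<Rightarrow> real ^ 'd"
  assumes dual: "dual_families u e" and le: "\<And>i. \<alpha> i \<le> \<beta> i"
  shows "measure lebesgue {x. \<forall>i. \<alpha> i \<le> u i \<bullet> x \<and> u i \<bullet> x \<le> \<beta> i} =
    (\<Prod>i\<in>UNIV. \<beta> i - \<alpha> i) * unit_parallelotope_volume u"
proof -
  let ?a = "\<Sum>i\<in>UNIV. \<alpha> i *\<^sub>R e i"
  have a: "u i \<bullet> ?a = \<alpha> i" for i by (simp only: dual_families_inner_sum[OF dual])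
  have "{x. \<forall>i. \<alpha> i \<le> u i \<bullet> x \<and> u i \<bullet> x \<le> \<beta> i} = (+) ?a ` zonotope e (\<lambda>i. \<beta> i - \<alpha> i)" (is "?S = _ ` ?Z")
  proof (intro set_eqI iffI)
    fix x assume "x \<in> ?S"
    then have "x - ?a \<in> ?Z"
      unfolding parallelotope_eq_zonotope[OF dual, symmetric] parallelotope_def
      by (simp add: inner_diff_right a)
    then have "?a + (x - ?a) \<in> (+) ?a ` ?Z" by (rule imageI)
    then show "x \<in> (+) ?a ` ?Z" by simp
  next
    fix x assume "x \<in> (+) ?a ` ?Z"
    then obtain y where y: "x = ?a + y" "y \<in> ?Z" by blast
    then have "0 \<le> u i \<bullet> y" "u i \<bullet> y \<le> \<beta> i - \<alpha> i" for i
      unfolding parallelotope_eq_zonotope[OF dual, symmetric] parallelotope_def by blast+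
    moreover have "u i \<bullet> x = \<alpha> i + u i \<bullet> y" for i
      unfolding y(1) inner_add_right a ..
    ultimately show "x \<in> ?S"
      by (simp add: le_diff_eq add.commute)
  qed
  then have "measure lebesgue {x. \<forall>i. \<alpha> i \<le> u i \<bullet> x \<and> u i \<bullet> x \<le> \<beta> i} = measure lebesgue (zonotope e (\<lambda>i. \<beta> i - \<alpha> i))"
    by (simp only: measure_translation)
  also have "\<dots> = (\<Prod>i\<in>UNIV. \<beta> i - \<alpha> i) * unit_parallelotope_volume u"
    using le by (intro zonotope_measure[OF dual]) simp
  finally show ?thesis .
qed

lemma unit_parallelotope_volume_pos:
  assumes dual: "dual_families u e"
  shows "0 < unit_parallelotope_volume u"
proof -
  have "\<not> negligible (parallelotope u (\<lambda>_. 1))"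
    using parallelotope_full[OF dual, of "\<lambda>_. 1"] zonotope_compact_convex(2)[of e "\<lambda>_. 1"]
    by (simp add: full_polytopes_def negligible_convex_interior parallelotope_eq_zonotope[OF dual])
  moreover have "parallelotope u (\<lambda>_. 1) \<in> lmeasurable"
    by (simp add: parallelotope_eq_zonotope[OF dual] lmeasurable_compact zonotope_compact_convex)
  ultimately have "measure lebesgue (parallelotope u (\<lambda>_. 1)) \<noteq> 0"
    unfolding negligible_iff_measure by blast
  then show ?thesis
    unfolding unit_parallelotope_volume_def zero_less_measure_iff .
qed

section \<open>Intrinsic volumes of parallelotopes\<close>

definition dilated_zonotope :: "('d::finite \<Rightarrow> real ^ 'd) \<Rightarrow> ('d \<Rightarrow> real) \<Rightarrow> (real ^ 'd) set" where
  "dilated_zonotope e s = {x + y |x y. x \<in> cball 0 1 \<and> y \<in> zonotope e s}"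

lemma dilated_zonotope_compact_convex:
  fixes e :: "'d::finite \<Rightarrow> real ^ 'd"
  shows "compact (dilated_zonotope e s)" "convex (dilated_zonotope e s)"
proof -
  show "compact (dilated_zonotope e s)"
    unfolding dilated_zonotope_def by (intro compact_sums compact_cball zonotope_compact_convex)
  have "dilated_zonotope e s = (\<Union>x\<in>cball 0 1. \<Union>y\<in>zonotope e s. {x + y})"
    unfolding dilated_zonotope_def by blast
  then show "convex (dilated_zonotope e s)"
    using convex_sums[OF convex_cball zonotope_compact_convex(2)] by simp
qed

lemma dilated_zonotope_update:
  fixes e :: "'d::finite \<Rightarrow> real ^ 'd"
  shows "dilated_zonotope e (s(j := t)) =
    {x + \<tau> *\<^sub>R e j |x \<tau>. x \<in> dilated_zonotope e (s(j := 0)) \<and> 0 \<le> \<tau> \<and> \<tau> \<le> t}"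
proof (intro set_eqI iffI)
  fix x assume "x \<in> dilated_zonotope e (s(j := t))"
  then obtain a b \<tau> where *: "x = a + (b + \<tau> *\<^sub>R e j)" "a \<in> cball 0 1" "b \<in> zonotope e (s(j := 0))" "0 \<le> \<tau>" "\<tau> \<le> t"
    unfolding dilated_zonotope_def zonotope_update[of e s j t] by blast
  then have "a + b \<in> dilated_zonotope e (s(j := 0))"
    unfolding dilated_zonotope_def by blast
  moreover have "x = (a + b) + \<tau> *\<^sub>R e j"
    using * by (simp add: add.assoc)
  ultimately show "x \<in> {x + \<tau> *\<^sub>R e j |x \<tau>. x \<in> dilated_zonotope e (s(j := 0)) \<and> 0 \<le> \<tau> \<and> \<tau> \<le> t}"
    using * by blast
next
  fix x assume "x \<in> {x + \<tau> *\<^sub>R e j |x \<tau>. x \<in> dilated_zonotope e (s(j := 0)) \<and> 0 \<le> \<tau> \<and> \<tau> \<le> t}"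
  then obtain a b \<tau> where *: "x = (a + b) + \<tau> *\<^sub>R e j" "a \<in> cball 0 1" "b \<in> zonotope e (s(j := 0))" "0 \<le> \<tau>" "\<tau> \<le> t"
    unfolding dilated_zonotope_def by blast
  then have "b + \<tau> *\<^sub>R e j \<in> zonotope e (s(j := t))"
    unfolding zonotope_update[of e s j t] by blast
  moreover have "x = a + (b + \<tau> *\<^sub>R e j)"
    using * by (simp add: add.assoc)
  ultimately show "x \<in> dilated_zonotope e (s(j := t))"
    using * unfolding dilated_zonotope_def by blast
qed

text \<open>Each edge enters as a Minkowski summand, and the volume is affine in its length.\<close>

lemma dilated_zonotope_volume:
  fixes e :: "'d::finite \<Rightarrow> real ^ 'd"
  shows "\<exists>c. \<forall>s. (\<forall>i. 0 \<le> s i) \<longrightarrow> measure lebesgue (dilated_zonotope e s) = (\<Sum>I\<in>UNIV. c I * (\<Prod>i\<in>I. s i))"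
proof -
  let ?G = "\<lambda>s. measure lebesgue (dilated_zonotope e s)"
  have step: "?G s = ?G (s(j := 0)) + s j * (?G (s(j := 1)) - ?G (s(j := 0)))" if "\<And>i. 0 \<le> s i" for s j
    using measure_segment_sum[OF dilated_zonotope_compact_convex[of e "s(j := 0)"] that[of j], of "e j"]
    unfolding dilated_zonotope_update[of e s j, symmetric] by (simp only: fun_upd_triv)
  show ?thesis
    using multiaffine_expansion[of UNIV ?G, OF finite step] by simp
qed

text \<open>The coefficient at \<open>I\<close> is the volume of the unit ball in dimension \<open>d - card I\<close> times the
  \<open>card I\<close>-dimensional volume of the parallelotope spanned by the vectors \<open>e i\<close> with \<open>i \<in> I\<close>.\<close>

definition zonotope_coeff :: "('d::finite \<Rightarrow> real ^ 'd) \<Rightarrow> 'd set \<Rightarrow> real" where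
  "zonotope_coeff e = (SOME c. \<forall>s. (\<forall>i. 0 \<le> s i) \<longrightarrow>
     measure lebesgue (dilated_zonotope e s) = (\<Sum>I\<in>UNIV. c I * (\<Prod>i\<in>I. s i)))"

lemma dilated_zonotope_measure:
  fixes e :: "'d::finite \<Rightarrow> real ^ 'd"
  assumes "\<And>i. 0 \<le> s i"
  shows "measure lebesgue (dilated_zonotope e s) = (\<Sum>I\<in>UNIV. zonotope_coeff e I * (\<Prod>i\<in>I. s i))"
  using someI_ex[OF dilated_zonotope_volume[of e]] assms unfolding zonotope_coeff_def by blast

text \<open>For side lengths that vanish outside \<open>I\<close> the two bodies coincide, and the coefficients of a
  multi-affine polynomial are determined by its values. This locality is what later prevents the
  intrinsic volume from blowing up when two facet normals outside \<open>I\<close> become parallel.\<close>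

lemma zonotope_coeff_local:
  fixes e e' :: "'d::finite \<Rightarrow> real ^ 'd"
  assumes "\<And>i. i \<in> I \<Longrightarrow> e i = e' i"
  shows "zonotope_coeff e I = zonotope_coeff e' I"
proof -
  have main: "zonotope_coeff e' I \<le> zonotope_coeff e I"
    if eq: "\<And>i. i \<in> I \<Longrightarrow> e i = e' i" for e e' :: "'d \<Rightarrow> real ^ 'd"
  proof -
    have "0 \<le> zonotope_coeff e I - zonotope_coeff e' I"
    proof (rule multiaffine_nonneg_coeffs[where F = I and c = "\<lambda>J. zonotope_coeff e J - zonotope_coeff e' J"])
      fix H :: "'d \<Rightarrow> real" assume H: "\<And>i. 0 < H i"
      define s where "s i = (if i \<in> I then H i else 0)" for i
      have s: "\<And>i. 0 \<le> s i" using H by (simp add: s_def less_imp_le)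
      have "(\<Sum>i\<in>UNIV. t i *\<^sub>R e i) = (\<Sum>i\<in>UNIV. t i *\<^sub>R e' i)" if "\<forall>i. 0 \<le> t i \<and> t i \<le> s i" for t
      proof (intro sum.cong refl)
        fix i show "t i *\<^sub>R e i = t i *\<^sub>R e' i"
          using that[rule_format, of i] eq[of i] by (cases "i \<in> I") (auto simp: s_def)
      qed
      then have "zonotope e s = zonotope e' s"
        unfolding zonotope_def by (intro Collect_cong ex_cong1) auto
      then have "(\<Sum>J\<in>UNIV. zonotope_coeff e J * (\<Prod>i\<in>J. s i)) = (\<Sum>J\<in>UNIV. zonotope_coeff e' J * (\<Prod>i\<in>J. s i))"
        by (simp add: dilated_zonotope_measure[OF s, symmetric] dilated_zonotope_def)
      moreover have "(\<Sum>J\<in>UNIV. c J * (\<Prod>i\<in>J. s i)) = (\<Sum>J\<in>Pow I. c J * (\<Prod>i\<in>J. H i))" for c :: "'d set \<Rightarrow> real"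
      proof -
        have "(\<Sum>J\<in>UNIV. c J * (\<Prod>i\<in>J. s i)) = (\<Sum>J\<in>Pow I. c J * (\<Prod>i\<in>J. s i))"
        proof (rule sum.mono_neutral_right)
          show "\<forall>J\<in>UNIV - Pow I. c J * (\<Prod>i\<in>J. s i) = 0"
          proof
            fix J assume "J \<in> UNIV - Pow I"
            then obtain i where "i \<in> J" "s i = 0" unfolding s_def by (metis DiffD2 PowI subsetI)
            then show "c J * (\<Prod>i\<in>J. s i) = 0" by (auto intro!: prod_zero)
          qed
        qed auto
        also have "\<dots> = (\<Sum>J\<in>Pow I. c J * (\<Prod>i\<in>J. H i))"
          by (intro sum.cong refl arg_cong2[of _ _ _ _ "(*)"] prod.cong) (auto simp: s_def)
        finally show ?thesis .
      qed
      ultimately show "0 \<le> (\<Sum>J\<in>Pow I. (zonotope_coeff e J - zonotope_coeff e' J) * (\<Prod>i\<in>J. H i))"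
        by (simp add: left_diff_distrib sum_subtractf)
    qed auto
    then show ?thesis by simp
  qed
  show ?thesis
    using main[of e e'] main[of e' e] assms by simp
qed

lemma sum_delta_mult:
  fixes f :: "'i::finite set \<Rightarrow> real"
  shows "(\<Sum>J\<in>UNIV. (if J = I then c else 0) * f J) = c * f I"
proof -
  have "(\<Sum>J\<in>UNIV. (if J = I then c else 0) * f J) = (\<Sum>J\<in>UNIV. if J = I then c * f J else 0)"
    by (intro sum.cong) auto
  then show ?thesis by simp
qed

text \<open>The dilated zonotope contains the parallelotope with side lengths \<open>H i\<close> for \<open>i \<in> I\<close> and \<open>\<delta>\<close> for the
  others, as the edges of length \<open>\<delta>\<close> together stay inside the unit ball.\<close>

lemma zonotope_coeff_ge:
  fixes u e :: "'d::finite \<Rightarrow> real ^ 'd"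
  assumes dual: "dual_families u e"
    and \<delta>: "0 \<le> \<delta>" "\<delta> * (\<Sum>i\<in>UNIV. norm (e i)) \<le> 1"
  shows "\<delta> ^ card (- I) * unit_parallelotope_volume u \<le> zonotope_coeff e I"
proof -
  let ?c = "\<delta> ^ card (- I) * unit_parallelotope_volume u"
  have "0 \<le> zonotope_coeff e I - (if I = I then ?c else 0)"
  proof (rule multiaffine_nonneg_coeffs[where F = UNIV and c = "\<lambda>J. zonotope_coeff e J - (if J = I then ?c else 0)"])
    fix H :: "'d \<Rightarrow> real" assume H: "\<And>i. 0 < H i"
    define s where "s i = (if i \<in> I then H i else \<delta>)" for i
    have s: "0 \<le> s i" for i using H[of i] \<delta> by (simp add: s_def)
    have sub: "parallelotope u s \<subseteq> dilated_zonotope e H"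
    proof
      fix x assume x: "x \<in> parallelotope u s"
      let ?a = "\<Sum>i\<in>UNIV. (if i \<in> I then 0 else u i \<bullet> x) *\<^sub>R e i"
      let ?b = "\<Sum>i\<in>UNIV. (if i \<in> I then u i \<bullet> x else 0) *\<^sub>R e i"
      have bd: "0 \<le> u i \<bullet> x" "u i \<bullet> x \<le> s i" for i
        using x by (auto simp: parallelotope_def)
      have "norm ?a \<le> (\<Sum>i\<in>UNIV. \<delta> * norm (e i))"
      proof (rule sum_norm_le)
        fix i show "norm ((if i \<in> I then 0 else u i \<bullet> x) *\<^sub>R e i) \<le> \<delta> * norm (e i)"
          using bd[of i] \<delta>(1) by (auto simp: s_def intro!: mult_right_mono)
      qed
      then have "?a \<in> cball 0 1"
        using \<delta>(2) by (simp add: sum_distrib_left)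
      moreover have "?b \<in> zonotope e H"
        using bd H unfolding zonotope_def
        by (intro CollectI exI[of _ "\<lambda>i. if i \<in> I then u i \<bullet> x else 0"]) (auto simp: s_def less_imp_le split: if_splits, metis)
      moreover have "x = ?a + ?b"
      proof -
        have "?a + ?b = (\<Sum>i\<in>UNIV. (u i \<bullet> x) *\<^sub>R e i)"
          unfolding sum.distrib[symmetric] by (intro sum.cong) auto
        then show ?thesis using dual_families_expansion[OF dual] by simp
      qed
      ultimately show "x \<in> dilated_zonotope e H"
        unfolding dilated_zonotope_def by blast
    qed
    have "(\<Prod>i\<in>UNIV. s i) = (\<Prod>i\<in>I. H i) * \<delta> ^ card (- I)"
    proof -
      have "(\<Prod>i\<in>UNIV. s i) = (\<Prod>i\<in>UNIV \<inter> I. H i) * (\<Prod>i\<in>UNIV - I. \<delta>)"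
        unfolding s_def by (subst prod.If_cases) (auto simp: Compl_eq_Diff_UNIV)
      then show ?thesis by (simp add: Compl_eq_Diff_UNIV)
    qed
    then have "?c * (\<Prod>i\<in>I. H i) = measure lebesgue (parallelotope u s)"
      using slab_measure[OF dual, of "\<lambda>_. 0" s] s by (simp add: parallelotope_def)
    also have "\<dots> \<le> measure lebesgue (dilated_zonotope e H)"
      using sub slab_compact[OF dual, of "\<lambda>_. 0" s]
      by (intro measure_mono_fmeasurable) (auto simp: parallelotope_def lmeasurable_compact dilated_zonotope_compact_convex fmeasurableD)
    also have "\<dots> = (\<Sum>J\<in>UNIV. zonotope_coeff e J * (\<Prod>i\<in>J. H i))"
      using H by (intro dilated_zonotope_measure) (simp add: less_imp_le)
    finally show "0 \<le> (\<Sum>J\<in>Pow UNIV. (zonotope_coeff e J - (if J = I then ?c else 0)) * (\<Prod>i\<in>J. H i))"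
      by (simp add: left_diff_distrib sum_subtractf sum_delta_mult)
  qed auto
  then show ?thesis by simp
qed

lemma zonotope_coeff_pos:
  fixes u e :: "'d::finite \<Rightarrow> real ^ 'd"
  assumes dual: "dual_families u e"
  shows "0 < zonotope_coeff e I"
proof -
  define \<delta> where "\<delta> = 1 / (1 + (\<Sum>i\<in>UNIV. norm (e i)))"
  have n: "0 \<le> (\<Sum>i\<in>UNIV. norm (e i))" by (simp add: sum_nonneg)
  then have \<delta>: "0 < \<delta>" "\<delta> * (\<Sum>i\<in>UNIV. norm (e i)) \<le> 1"
    by (auto simp: \<delta>_def field_simps)
  then have "0 < \<delta> ^ card (- I) * unit_parallelotope_volume u"
    using \<delta> unit_parallelotope_volume_pos[OF dual] by simp
  also have "\<dots> \<le> zonotope_coeff e I"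
    using \<delta> by (intro zonotope_coeff_ge[OF dual]) auto
  finally show ?thesis .
qed

text \<open>The dilated zonotope lies between the parallelotope itself and the parallelotope with all slabs
  thickened by a constant; both volumes have the same leading coefficient.\<close>

lemma zonotope_coeff_UNIV:
  fixes u e :: "'d::finite \<Rightarrow> real ^ 'd"
  assumes dual: "dual_families u e"
  shows "zonotope_coeff e UNIV = unit_parallelotope_volume u"
proof (rule antisym)
  show "unit_parallelotope_volume u \<le> zonotope_coeff e UNIV"
    using zonotope_coeff_ge[OF dual, of 0 UNIV] by simp
  define M where "M = (\<Sum>i\<in>UNIV. norm (u i))"
  have "0 \<le> (2 * M) ^ card (- (UNIV :: 'd set)) * unit_parallelotope_volume u - zonotope_coeff e UNIV"
  proof (rule multiaffine_nonneg_coeffs[where F = UNIV and c = "\<lambda>J. (2 * M) ^ card (- J) * unit_parallelotope_volume u - zonotope_coeff e J"])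
    fix H :: "'d \<Rightarrow> real" assume H: "\<And>i. 0 < H i"
    have M: "norm (u i) \<le> M" for i
      unfolding M_def by (intro member_le_sum) auto
    then have M0: "0 \<le> M" using norm_ge_zero order_trans by blast
    have sub: "dilated_zonotope e H \<subseteq> {x. \<forall>i. - M \<le> u i \<bullet> x \<and> u i \<bullet> x \<le> H i + M}"
    proof
      fix x assume "x \<in> dilated_zonotope e H"
      then obtain a b where x: "x = a + b" "norm a \<le> 1" "b \<in> parallelotope u H"
        unfolding dilated_zonotope_def parallelotope_eq_zonotope[OF dual] by auto
      have "\<bar>u i \<bullet> a\<bar> \<le> M" for i
      proof -
        have "\<bar>u i \<bullet> a\<bar> \<le> norm (u i) * norm a" by (rule Cauchy_Schwarz_ineq2)
        also have "\<dots> \<le> M * 1" using M x(2) M0 by (intro mult_mono) auto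
        finally show ?thesis by simp
      qed
      then have "- M \<le> u i \<bullet> x \<and> u i \<bullet> x \<le> H i + M" for i
        using x(3) by (auto simp: x(1) parallelotope_def inner_add_right abs_le_iff) (smt (verit))+
      then show "x \<in> {x. \<forall>i. - M \<le> u i \<bullet> x \<and> u i \<bullet> x \<le> H i + M}" by simp
    qed
    have "(\<Sum>J\<in>UNIV. zonotope_coeff e J * (\<Prod>i\<in>J. H i)) = measure lebesgue (dilated_zonotope e H)"
      using H by (intro dilated_zonotope_measure[symmetric]) (simp add: less_imp_le)
    also have "\<dots> \<le> measure lebesgue {x. \<forall>i. - M \<le> u i \<bullet> x \<and> u i \<bullet> x \<le> H i + M}"
      using sub slab_compact[OF dual, of "\<lambda>_. - M" "\<lambda>i. H i + M"]
      by (intro measure_mono_fmeasurable) (auto simp: lmeasurable_compact dilated_zonotope_compact_convex fmeasurableD)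
    also have "\<dots> = (\<Prod>i\<in>UNIV. H i + 2 * M) * unit_parallelotope_volume u"
      using H M0 by (subst slab_measure[OF dual]) (auto simp: less_imp_le add_nonneg_nonneg algebra_simps intro: order_trans[of _ 0])
    also have "(\<Prod>i\<in>UNIV. H i + 2 * M) = (\<Sum>J\<in>UNIV. (\<Prod>i\<in>J. H i) * (2 * M) ^ card (- J))"
      by (subst prod_add) (auto simp: Compl_eq_Diff_UNIV)
    finally show "0 \<le> (\<Sum>J\<in>Pow UNIV. ((2 * M) ^ card (- J) * unit_parallelotope_volume u - zonotope_coeff e J) * (\<Prod>i\<in>J. H i))"
      by (simp add: algebra_simps sum_subtractf sum_distrib_left)
  qed auto
  then show "zonotope_coeff e UNIV \<le> unit_parallelotope_volume u" by simp
qed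

text \<open>For \<open>r > 0\<close> scaling by \<open>1 / r\<close> reduces to the unit ball and produces the powers of \<open>r\<close>. At \<open>r = 0\<close>
  only the coefficient at \<open>UNIV\<close> survives, and it gives the volume.\<close>

lemma parallelotope_parallel_volume:
  fixes u e :: "'d::finite \<Rightarrow> real ^ 'd"
  assumes dual: "dual_families u e" and H: "\<And>i. 0 < H i" and r: "0 \<le> r"
  shows "measure lebesgue {x + y |x y. x \<in> parallelotope u H \<and> y \<in> cball 0 r} =
    (\<Sum>I\<in>UNIV. r ^ (CARD('d) - card I) * (zonotope_coeff e I * (\<Prod>i\<in>I. H i)))"
proof (cases "r = 0")
  case True
  have "{x + y |x y. x \<in> parallelotope u H \<and> y \<in> cball 0 r} = parallelotope u H"
    using True by auto
  then have "measure lebesgue {x + y |x y. x \<in> parallelotope u H \<and> y \<in> cball 0 r} = zonotope_coeff e UNIV * (\<Prod>i\<in>UNIV. H i)"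
    using slab_measure[OF dual, of "\<lambda>_. 0" H] H zonotope_coeff_UNIV[OF dual]
    by (simp add: parallelotope_def less_imp_le)
  also have "\<dots> = (\<Sum>I\<in>UNIV. (if I = UNIV then 1 else 0) * (zonotope_coeff e I * (\<Prod>i\<in>I. H i)))"
    by (simp add: sum_delta_mult)
  also have "\<dots> = (\<Sum>I\<in>UNIV. r ^ (CARD('d) - card I) * (zonotope_coeff e I * (\<Prod>i\<in>I. H i)))"
  proof (intro sum.cong refl)
    fix I :: "'d set"
    have "card I < CARD('d)" if "I \<noteq> UNIV"
      using that by (intro psubset_card_mono) auto
    then show "(if I = UNIV then 1 else 0) * (zonotope_coeff e I * (\<Prod>i\<in>I. H i)) =
        r ^ (CARD('d) - card I) * (zonotope_coeff e I * (\<Prod>i\<in>I. H i))"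
      by (simp add: True)
  qed
  finally show ?thesis .
next
  case False
  with r have r: "0 < r" by simp
  define s where "s i = H i / r" for i
  have s: "0 \<le> s i" for i using H[of i] r by (simp add: s_def)
  have "{x + y |x y. x \<in> parallelotope u H \<and> y \<in> cball 0 r} = (\<lambda>x. r *\<^sub>R x + 0) ` dilated_zonotope e s"
  proof (intro set_eqI iffI)
    fix z assume "z \<in> {x + y |x y. x \<in> parallelotope u H \<and> y \<in> cball 0 r}"
    then obtain x y where z: "z = x + y" "x \<in> parallelotope u H" "norm y \<le> r" by auto
    have "(1 / r) *\<^sub>R x \<in> parallelotope u s" "(1 / r) *\<^sub>R y \<in> cball 0 1"
      using z r by (auto simp: parallelotope_def s_def divide_right_mono)
    then have "(1 / r) *\<^sub>R y + (1 / r) *\<^sub>R x \<in> dilated_zonotope e s"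
      unfolding dilated_zonotope_def parallelotope_eq_zonotope[OF dual] by blast
    moreover have "z = r *\<^sub>R ((1 / r) *\<^sub>R y + (1 / r) *\<^sub>R x) + 0"
      using z r by (simp add: scaleR_add_right)
    ultimately show "z \<in> (\<lambda>x. r *\<^sub>R x + 0) ` dilated_zonotope e s" by blast
  next
    fix z assume "z \<in> (\<lambda>x. r *\<^sub>R x + 0) ` dilated_zonotope e s"
    then obtain a b where z: "z = r *\<^sub>R (a + b)" "norm a \<le> 1" "b \<in> parallelotope u s"
      unfolding dilated_zonotope_def parallelotope_eq_zonotope[OF dual] by auto
    have "r *\<^sub>R b \<in> parallelotope u H" "r *\<^sub>R a \<in> cball 0 r"
      using z r by (auto simp: parallelotope_def s_def field_simps mult_left_le)
    moreover have "z = r *\<^sub>R b + r *\<^sub>R a"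
      by (simp add: z(1) scaleR_add_right)
    ultimately show "z \<in> {x + y |x y. x \<in> parallelotope u H \<and> y \<in> cball 0 r}" by blast
  qed
  then have "measure lebesgue {x + y |x y. x \<in> parallelotope u H \<and> y \<in> cball 0 r} =
      r ^ CARD('d) * measure lebesgue (dilated_zonotope e s)"
    using measure_lebesgue_affine[of r 0 "dilated_zonotope e s"] r by simp
  also have "\<dots> = (\<Sum>I\<in>UNIV. r ^ CARD('d) * (zonotope_coeff e I * (\<Prod>i\<in>I. s i)))"
    by (simp add: dilated_zonotope_measure[OF s] sum_distrib_left)
  also have "\<dots> = (\<Sum>I\<in>UNIV. r ^ (CARD('d) - card I) * (zonotope_coeff e I * (\<Prod>i\<in>I. H i)))"
  proof (intro sum.cong refl)
    fix I :: "'d set"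
    have "card I \<le> CARD('d)" by (simp add: card_mono)
    then have "r ^ CARD('d) = r ^ (CARD('d) - card I) * r ^ card I"
      by (simp add: power_add[symmetric])
    moreover have "(\<Prod>i\<in>I. s i) = (\<Prod>i\<in>I. H i) / r ^ card I"
      by (simp add: s_def prod_dividef)
    ultimately show "r ^ CARD('d) * (zonotope_coeff e I * (\<Prod>i\<in>I. s i)) =
        r ^ (CARD('d) - card I) * (zonotope_coeff e I * (\<Prod>i\<in>I. H i))"
      using r by simp
  qed
  finally show ?thesis .
qed

text \<open>Two Steiner polynomials of the same body agree on \<open>[0, \<infinity>)\<close>, hence have equal coefficients.\<close>

lemma intrinsic_volume_eqI:
  fixes X :: "(real ^ 'd::finite) set"
  assumes V: "steiner_formula X V" and q: "q \<le> CARD('d)"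
  shows "intrinsic_volume q X = V q"
  unfolding intrinsic_volume_def
proof (rule the_equality)
  show "\<exists>V'. steiner_formula X V' \<and> V' q = V q" using V by blast
next
  fix v assume "\<exists>V'. steiner_formula X V' \<and> V' q = v"
  then obtain V' where V': "steiner_formula X V'" "V' q = v" by blast
  let ?d = "CARD('d)"
  let ?c = "\<lambda>k. unit_ball_vol (real k) * (V (?d - k) - V' (?d - k))"
  have "(\<Sum>k\<le>?d. ?c k * r ^ k) = 0" if "0 \<le> r" for r
  proof -
    have "(\<Sum>k\<le>?d. ?c k * r ^ k) =
        (\<Sum>q = 0..?d. r ^ (?d - q) * unit_ball_vol (real (?d - q)) * V q) -
        (\<Sum>q = 0..?d. r ^ (?d - q) * unit_ball_vol (real (?d - q)) * V' q)"
      unfolding sum_subtractf[symmetric]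
      by (rule sum.reindex_bij_witness[of _ "\<lambda>q. ?d - q" "\<lambda>k. ?d - k"]) (auto simp: algebra_simps)
    then show ?thesis
      using V V'(1) that unfolding steiner_formula_def by simp
  qed
  then have "{0..} \<subseteq> {r. (\<Sum>k\<le>?d. ?c k * r ^ k) = 0}" by auto
  then have "infinite {r. (\<Sum>k\<le>?d. ?c k * r ^ k) = 0}"
    using infinite_Ici finite_subset by blast
  then have "?c (?d - q) = 0"
    using polyfun_finite_roots[of ?c ?d] by (meson diff_le_self)
  moreover have "unit_ball_vol (real (?d - q)) \<noteq> 0"
    by (metis less_irrefl of_nat_0_le_iff unit_ball_vol_pos)
  ultimately show "v = V q"
    using q V'(2) by simp
qed

lemma parallelotope_intrinsic_volume:
  fixes u e :: "'d::finite \<Rightarrow> real ^ 'd"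
  assumes dual: "dual_families u e" and H: "\<And>i. 0 < H i" and q: "q \<le> CARD('d)"
  shows "intrinsic_volume q (parallelotope u H) =
    (\<Sum>I | card I = q. zonotope_coeff e I * (\<Prod>i\<in>I. H i)) / unit_ball_vol (real (CARD('d) - q))"
proof -
  let ?d = "CARD('d)"
  define V where "V q = (\<Sum>I | card I = q. zonotope_coeff e I * (\<Prod>i\<in>I. H i)) / unit_ball_vol (real (?d - q))" for q
  have "steiner_formula (parallelotope u H) V"
    unfolding steiner_formula_def
  proof (intro allI impI)
    fix r :: real assume r: "0 \<le> r"
    let ?h = "\<lambda>I. r ^ (?d - card I) * (zonotope_coeff e I * (\<Prod>i\<in>I. H i))"
    have "(\<Sum>I\<in>UNIV. ?h I) = (\<Sum>q\<in>{0..?d}. \<Sum>I\<in>{I \<in> UNIV. card I = q}. ?h I)"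
      by (rule sum.group[symmetric]) (auto simp: card_mono)
    also have "\<dots> = (\<Sum>q = 0..?d. r ^ (?d - q) * unit_ball_vol (real (?d - q)) * V q)"
    proof (intro sum.cong refl)
      fix q
      have "unit_ball_vol (real (?d - q)) \<noteq> 0"
        by (metis less_irrefl of_nat_0_le_iff unit_ball_vol_pos)
      then show "(\<Sum>I\<in>{I \<in> UNIV. card I = q}. ?h I) = r ^ (?d - q) * unit_ball_vol (real (?d - q)) * V q"
        by (simp add: V_def sum_distrib_left[symmetric])
    qed
    finally show "measure lebesgue {x + y |x y. x \<in> parallelotope u H \<and> y \<in> cball 0 r} =
        (\<Sum>q = 0..?d. r ^ (?d - q) * unit_ball_vol (real (?d - q)) * V q)"
      using parallelotope_parallel_volume[OF dual H r] by simp
  qed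
  then show ?thesis
    using intrinsic_volume_eqI[OF _ q] unfolding V_def by blast
qed

section \<open>The mean number of lattice points in a randomly shifted set\<close>

lemma lattice_of_iff:
  assumes "dual_families \<eta> \<xi>"
  shows "z \<in> lattice_of \<xi> \<longleftrightarrow> (\<forall>i. \<eta> i \<bullet> z \<in> \<int>)"
proof
  assume "z \<in> lattice_of \<xi>"
  then obtain m where "z = (\<Sum>i\<in>UNIV. real_of_int (m i) *\<^sub>R \<xi> i)"
    unfolding lattice_of_def by auto
  then show "\<forall>i. \<eta> i \<bullet> z \<in> \<int>"
    by (simp only: dual_families_inner_sum[OF assms] Ints_of_int simp_thms)
next
  assume "\<forall>i. \<eta> i \<bullet> z \<in> \<int>"
  then have "\<forall>i. \<exists>m. \<eta> i \<bullet> z = real_of_int m"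
    unfolding Ints_def by blast
  then obtain m where "\<And>i. \<eta> i \<bullet> z = real_of_int (m i)"
    by metis
  then have "z = (\<Sum>i\<in>UNIV. real_of_int (m i) *\<^sub>R \<xi> i)"
    using dual_families_expansion[OF assms, of z] by simp
  then show "z \<in> lattice_of \<xi>"
    unfolding lattice_of_def by blast
qed

lemma unit_cell_eq_parallelotope:
  assumes "dual_families \<eta> \<xi>"
  shows "unit_cell \<xi> = parallelotope \<eta> (\<lambda>_. 1)"
  unfolding parallelotope_eq_zonotope[OF assms] unit_cell_def zonotope_def by simp

lemma dual_families_eqI:
  assumes "dual_families u e" "\<And>i. u i \<bullet> x = u i \<bullet> y"
  shows "x = y"
proof -
  have "x = (\<Sum>i\<in>UNIV. (u i \<bullet> x) *\<^sub>R e i)"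
    by (rule dual_families_expansion[OF assms(1), symmetric])
  also have "\<dots> = (\<Sum>i\<in>UNIV. (u i \<bullet> y) *\<^sub>R e i)"
    by (simp only: assms(2))
  also have "\<dots> = y"
    by (rule dual_families_expansion[OF assms(1)])
  finally show ?thesis .
qed

lemma finite_lattice_ball:
  fixes \<xi> :: "'d::finite \<Rightarrow> real ^ 'd"
  assumes dual: "dual_families \<eta> \<xi>"
  shows "finite {z \<in> lattice_of \<xi>. norm z \<le> r}"
proof -
  define N where "N = \<lceil>(\<Sum>i\<in>UNIV. norm (\<eta> i)) * r\<rceil>"
  let ?S = "(\<lambda>m. \<Sum>i\<in>UNIV. real_of_int (m i) *\<^sub>R \<xi> i) ` (PiE UNIV (\<lambda>_. {- N..N}))"
  have "{z \<in> lattice_of \<xi>. norm z \<le> r} \<subseteq> ?S"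
  proof
    fix z assume "z \<in> {z \<in> lattice_of \<xi>. norm z \<le> r}"
    then obtain m where m: "z = (\<Sum>i\<in>UNIV. real_of_int (m i) *\<^sub>R \<xi> i)" and r: "norm z \<le> r"
      unfolding lattice_of_def by auto
    have "m i \<in> {- N..N}" for i
    proof -
      have "\<bar>real_of_int (m i)\<bar> = \<bar>\<eta> i \<bullet> z\<bar>"
        unfolding m by (simp only: dual_families_inner_sum[OF dual])
      also have "\<dots> \<le> norm (\<eta> i) * norm z" by (rule Cauchy_Schwarz_ineq2)
      also have "\<dots> \<le> (\<Sum>i\<in>UNIV. norm (\<eta> i)) * r"
        using r by (intro mult_mono member_le_sum sum_nonneg) auto
      also have "\<dots> \<le> real_of_int N"
        unfolding N_def by (rule le_of_int_ceiling)
      finally show ?thesis by auto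
    qed
    then show "z \<in> ?S"
      unfolding m by (intro imageI) auto
  qed
  moreover have "finite ?S"
    by (intro finite_imageI finite_PiE) auto
  ultimately show ?thesis by (rule finite_subset)
qed

text \<open>The translates of the half-open cell by lattice points tile the space, and the closed cell exceeds
  the half-open one by a null set. The finite set \<open>F\<close> only has to contain the lattice points whose
  cell meets \<open>D\<close>.\<close>

lemma lattice_tiling_measure:
  fixes \<xi> :: "'d::finite \<Rightarrow> real ^ 'd"
  assumes dual: "dual_families \<eta> \<xi>" and D: "D \<in> sets borel" "bounded D"
    and F: "F \<subseteq> lattice_of \<xi>" "finite F"
    and cover: "\<And>z c. z \<in> lattice_of \<xi> \<Longrightarrow> c \<in> unit_cell \<xi> \<Longrightarrow> z + c \<in> D \<Longrightarrow> z \<in> F"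
  shows "(\<Sum>z\<in>F. measure lborel (unit_cell \<xi> \<inter> {c. z + c \<in> D})) = measure lborel D"
proof -
  let ?C0 = "{x. \<forall>i. 0 \<le> \<eta> i \<bullet> x \<and> \<eta> i \<bullet> x < 1}"
  have C0[measurable]: "?C0 \<in> sets borel" by measurable
  have C[measurable]: "unit_cell \<xi> \<in> sets borel"
    unfolding unit_cell_eq_parallelotope[OF dual] parallelotope_def by measurable
  note D(1)[measurable]
  have D': "{c. z + c \<in> D} \<in> sets borel" for z by measurable
  have C_bounded: "bounded (unit_cell \<xi>)"
    unfolding unit_cell_eq_parallelotope[OF dual] parallelotope_eq_zonotope[OF dual]
    by (intro compact_imp_bounded zonotope_compact_convex)
  have C0_sub: "?C0 \<subseteq> unit_cell \<xi>"
    unfolding unit_cell_eq_parallelotope[OF dual] parallelotope_def by (auto simp: less_imp_le)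
  have negl: "negligible (unit_cell \<xi> - ?C0)"
  proof (rule negligible_subset)
    have "\<eta> i \<noteq> 0" for i
      using dual unfolding dual_families_def by (metis inner_zero_left zero_neq_one)
    then show "negligible (\<Union>i. {x. \<eta> i \<bullet> x = 1})"
      by (intro negligible_Union) (auto intro!: negligible_hyperplane)
    show "unit_cell \<xi> - ?C0 \<subseteq> (\<Union>i. {x. \<eta> i \<bullet> x = 1})"
    proof
      fix x assume "x \<in> unit_cell \<xi> - ?C0"
      then obtain i where "\<eta> i \<bullet> x \<le> 1" "\<not> \<eta> i \<bullet> x < 1"
        unfolding unit_cell_eq_parallelotope[OF dual] parallelotope_def by blast
      then have "\<eta> i \<bullet> x = 1" by simp
      then show "x \<in> (\<Union>i. {x. \<eta> i \<bullet> x = 1})" by blast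
    qed
  qed
  have tile: "measure lborel (unit_cell \<xi> \<inter> {c. z + c \<in> D}) = measure lborel ((+) z ` ?C0 \<inter> D)" for z
  proof -
    have "measure lborel (unit_cell \<xi> \<inter> {c. z + c \<in> D}) = measure lebesgue (unit_cell \<xi> \<inter> {c. z + c \<in> D})"
      using D' by simp
    also have "\<dots> = measure lebesgue (?C0 \<inter> {c. z + c \<in> D})"
    proof (rule measure_negligible_symdiff)
      show "?C0 \<inter> {c. z + c \<in> D} \<in> lmeasurable"
        using D' C0 by (intro bounded_set_imp_lmeasurable bounded_subset[OF C_bounded]) (use C0_sub in auto)
      show "negligible (?C0 \<inter> {c. z + c \<in> D} - unit_cell \<xi> \<inter> {c. z + c \<in> D} \<union>
          (unit_cell \<xi> \<inter> {c. z + c \<in> D} - ?C0 \<inter> {c. z + c \<in> D}))"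
        using negl by (rule negligible_subset) (use C0_sub in auto)
    qed
    also have "\<dots> = measure lebesgue ((+) z ` (?C0 \<inter> {c. z + c \<in> D}))"
      by (rule measure_translation[symmetric])
    also have "(+) z ` (?C0 \<inter> {c. z + c \<in> D}) = (+) z ` ?C0 \<inter> D" by auto
    also have "measure lebesgue \<dots> = measure lborel \<dots>"
    proof -
      have "(+) z ` ?C0 \<inter> D = {x. x - z \<in> ?C0} \<inter> D" by (force simp: image_iff)
      moreover have "{x. x - z \<in> ?C0} \<in> sets borel" by measurable
      ultimately show ?thesis by simp
    qed
    finally show ?thesis .
  qed
  have "(\<Sum>z\<in>F. measure lborel (unit_cell \<xi> \<inter> {c. z + c \<in> D})) = (\<Sum>z\<in>F. measure lborel ((+) z ` ?C0 \<inter> D))"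
    by (simp add: tile)
  also have "\<dots> = measure lborel (\<Union>z\<in>F. (+) z ` ?C0 \<inter> D)"
  proof (rule measure_finite_Union[symmetric])
    have "(+) z ` ?C0 \<inter> D = {x. x - z \<in> ?C0} \<inter> D" for z by (force simp: image_iff)
    then show meas: "(\<lambda>z. (+) z ` ?C0 \<inter> D) ` F \<subseteq> sets lborel" by auto
    show "emeasure lborel ((+) z ` ?C0 \<inter> D) \<noteq> \<infinity>" if "z \<in> F" for z
      using emeasure_bounded_finite[OF bounded_subset[OF D(2), of "(+) z ` ?C0 \<inter> D"]] by auto
    show "disjoint_family_on (\<lambda>z. (+) z ` ?C0 \<inter> D) F"
    proof (unfold disjoint_family_on_def, intro ballI impI)
      fix z z' assume z: "z \<in> F" "z' \<in> F" "z \<noteq> z'"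
      have False if "z + c = z' + c'" "c \<in> ?C0" "c' \<in> ?C0" for c c'
      proof -
        have "\<eta> i \<bullet> z = \<eta> i \<bullet> z'" for i
        proof -
          have "\<eta> i \<bullet> z + \<eta> i \<bullet> c = \<eta> i \<bullet> z' + \<eta> i \<bullet> c'"
            using that(1) by (metis inner_add_right)
          moreover have "0 \<le> \<eta> i \<bullet> c" "\<eta> i \<bullet> c < 1" "0 \<le> \<eta> i \<bullet> c'" "\<eta> i \<bullet> c' < 1"
            using that by auto
          moreover obtain p p' where p: "\<eta> i \<bullet> z = real_of_int p" "\<eta> i \<bullet> z' = real_of_int p'"
            using z F(1) lattice_of_iff[OF dual] by (metis Ints_cases subsetD)
          ultimately have "real_of_int p < real_of_int (p' + 1)" "real_of_int p' < real_of_int (p + 1)"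
            by simp_all
          then have "p = p'" unfolding of_int_less_iff by simp
          with p show ?thesis by simp
        qed
        then show False
          using dual_families_eqI[OF dual] z(3) by blast
      qed
      then show "((+) z ` ?C0 \<inter> D) \<inter> ((+) z' ` ?C0 \<inter> D) = {}" by blast
    qed
  qed (rule F)
  also have "(\<Union>z\<in>F. (+) z ` ?C0 \<inter> D) = D"
  proof (intro equalityI subsetI)
    fix x assume x: "x \<in> D"
    define z where "z = (\<Sum>i\<in>UNIV. real_of_int \<lfloor>\<eta> i \<bullet> x\<rfloor> *\<^sub>R \<xi> i)"
    have z: "z \<in> lattice_of \<xi>" unfolding z_def lattice_of_def by (intro CollectI exI[of _ "\<lambda>i. \<lfloor>\<eta> i \<bullet> x\<rfloor>"]) simp
    have "\<eta> i \<bullet> (x - z) = \<eta> i \<bullet> x - of_int \<lfloor>\<eta> i \<bullet> x\<rfloor>" for i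
      unfolding inner_diff_right z_def by (simp only: dual_families_inner_sum[OF dual])
    then have "0 \<le> \<eta> i \<bullet> (x - z) \<and> \<eta> i \<bullet> (x - z) < 1" for i
      by (simp only:) linarith
    then have c: "x - z \<in> ?C0" by blast
    have eq: "z + (x - z) = x" by simp
    have "z \<in> F"
      using cover[OF z subsetD[OF C0_sub c]] x unfolding eq by blast
    moreover have "x \<in> (+) z ` ?C0"
      using imageI[OF c, of "(+) z"] unfolding eq .
    ultimately show "x \<in> (\<Union>z\<in>F. (+) z ` ?C0 \<inter> D)"
      using x by blast
  qed auto
  finally show ?thesis .
qed

text \<open>On the unit cell the count is a finite sum of indicator functions, so its mean is the sum that the
  tiling evaluates. Off the cell that finite sum may be too small; measurability of the count on the
  whole space comes from writing it as a limit of finite sums.\<close>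

lemma lattice_count_mean:
  fixes \<xi> :: "'d::finite \<Rightarrow> real ^ 'd"
  assumes dual: "dual_families \<eta> \<xi>" and D: "D \<in> sets borel" "bounded D"
  defines "f \<equiv> \<lambda>c. real (card {z \<in> lattice_of \<xi>. z + c \<in> D})"
  shows "integrable (uniform_measure lborel (unit_cell \<xi>)) f"
    and "integral\<^sup>L (uniform_measure lborel (unit_cell \<xi>)) f = measure lborel D / unit_parallelotope_volume \<eta>"
proof -
  let ?M = "uniform_measure lborel (unit_cell \<xi>)"
  note D(1)[measurable]
  have C[measurable]: "unit_cell \<xi> \<in> sets borel"
    unfolding unit_cell_eq_parallelotope[OF dual] parallelotope_def by measurable
  have vol: "measure lborel (unit_cell \<xi>) = unit_parallelotope_volume \<eta>"
  proof -
    have "measure lborel (unit_cell \<xi>) = measure lebesgue (unit_cell \<xi>)" using C by simp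
    then show ?thesis
      by (simp add: unit_parallelotope_volume_def unit_cell_eq_parallelotope[OF dual])
  qed
  have C_bounded: "bounded (unit_cell \<xi>)"
    unfolding unit_cell_eq_parallelotope[OF dual] parallelotope_eq_zonotope[OF dual]
    by (intro compact_imp_bounded zonotope_compact_convex)
  have emeasure_pos: "emeasure lborel (unit_cell \<xi>) \<noteq> 0"
    using vol unit_parallelotope_volume_pos[OF dual] by (auto simp: measure_def)
  have emeasure_fin: "emeasure lborel (unit_cell \<xi>) \<noteq> \<infinity>"
    using emeasure_bounded_finite[OF C_bounded] by auto
  interpret fm: finite_measure ?M
    by (rule finite_measureI) (use emeasure_pos emeasure_fin in \<open>simp add: emeasure_uniform_measure ennreal_divide_eq_top_iff\<close>)
  define F where "F k = {z \<in> lattice_of \<xi>. norm z \<le> real k}" for k :: nat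
  have F: "finite (F k)" "F k \<subseteq> lattice_of \<xi>" for k
    using finite_lattice_ball[OF dual] by (auto simp: F_def)
  define g where "g k c = (\<Sum>z\<in>F k. indicator D (z + c) :: real)" for k c
  have g[measurable]: "g k \<in> borel_measurable borel" for k
    unfolding g_def by measurable
  obtain R where R: "\<And>x. x \<in> D \<Longrightarrow> norm x \<le> R"
    using D(2) by (auto simp: bounded_iff)
  obtain RC where RC: "\<And>x. x \<in> unit_cell \<xi> \<Longrightarrow> norm x \<le> RC"
    using C_bounded by (auto simp: bounded_iff)
  have inF: "z \<in> F k" if "z \<in> lattice_of \<xi>" "z + c \<in> D" "R + norm c \<le> real k" for z c k
  proof -
    have "norm z \<le> norm (z + c) + norm c"
      by (metis add_diff_cancel norm_triangle_ineq4)
    then show ?thesis using that R[OF that(2)] by (simp add: F_def)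
  qed
  have fg: "f c = g k c" if "R + norm c \<le> real k" for c k
  proof -
    have "{z \<in> lattice_of \<xi>. z + c \<in> D} = {z \<in> F k. z + c \<in> D}"
      using inF[OF _ _ that] F(2) by blast
    then have "f c = (\<Sum>z\<in>{z \<in> F k. z + c \<in> D}. 1)"
      by (simp add: f_def)
    also have "\<dots> = (\<Sum>z\<in>F k. if z + c \<in> D then 1 else 0)"
      by (rule sum.inter_filter[OF F(1)])
    also have "\<dots> = g k c"
      unfolding g_def by (intro sum.cong) (auto simp: indicator_def)
    finally show ?thesis .
  qed
  have f[measurable]: "f \<in> borel_measurable borel"
  proof (rule borel_measurable_LIMSEQ_real)
    fix c :: "real ^ 'd"
    obtain k0 :: nat where "R + norm c \<le> real k0" using real_arch_simple by blast
    then have "\<forall>\<^sub>F k in sequentially. g k c = f c"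
      unfolding eventually_sequentially by (intro exI[of _ k0]) (auto intro!: fg[symmetric])
    then show "(\<lambda>k. g k c) \<longlonglongrightarrow> f c" by (rule tendsto_eventually)
  qed measurable
  obtain k :: nat where k: "R + RC \<le> real k" using real_arch_simple by blast
  have AE: "AE c in ?M. f c = g k c"
  proof (rule AE_uniform_measureI[OF _ AE_I2])
    show "c \<in> unit_cell \<xi> \<longrightarrow> f c = g k c" for c
      using fg[of c k] RC[of c] k by auto
  qed simp
  have D': "{c. z + c \<in> D} \<in> sets borel" for z by measurable
  have ind: "(\<lambda>c. indicator D (z + c) :: real) = indicator {c. z + c \<in> D}" for z
    by (auto simp: indicator_def)
  have int_ind: "integrable ?M (\<lambda>c. indicator D (z + c) :: real)" for z
    unfolding ind using D' fm.emeasure_finite[of "{c. z + c \<in> D}"]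
    by (intro integrable_real_indicator) (simp_all add: less_top[symmetric] del: emeasure_uniform_measure)
  have int_g: "integrable ?M (g k)"
    unfolding g_def using int_ind by (intro Bochner_Integration.integrable_sum)
  show "integrable ?M f"
    using int_g AE by (subst integrable_cong_AE) auto
  have "integral\<^sup>L ?M f = integral\<^sup>L ?M (g k)"
    using AE by (intro integral_cong_AE) auto
  also have "\<dots> = (\<Sum>z\<in>F k. integral\<^sup>L ?M (\<lambda>c. indicator D (z + c)))"
    unfolding g_def using int_ind by (intro Bochner_Integration.integral_sum)
  also have "\<dots> = (\<Sum>z\<in>F k. measure lborel (unit_cell \<xi> \<inter> {c. z + c \<in> D}) / unit_parallelotope_volume \<eta>)"
  proof (intro sum.cong refl)
    fix z
    have "integral\<^sup>L ?M (\<lambda>c. indicator D (z + c)) = measure ?M {c. z + c \<in> D}"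
      unfolding ind by simp
    also have "\<dots> = measure lborel (unit_cell \<xi> \<inter> {c. z + c \<in> D}) / unit_parallelotope_volume \<eta>"
      using D' emeasure_pos emeasure_fin by (subst measure_uniform_measure) (auto simp: vol)
    finally show "integral\<^sup>L ?M (\<lambda>c. indicator D (z + c)) = measure lborel (unit_cell \<xi> \<inter> {c. z + c \<in> D}) / unit_parallelotope_volume \<eta>" .
  qed
  also have "\<dots> = measure lborel D / unit_parallelotope_volume \<eta>"
    unfolding sum_divide_distrib[symmetric]
  proof (subst lattice_tiling_measure[OF dual D F(2,1)])
    fix z c assume "z \<in> lattice_of \<xi>" "c \<in> unit_cell \<xi>" "z + c \<in> D"
    then show "z \<in> F k" using inF[of z c k] RC[of c] k by auto
  qed simp
  finally show "integral\<^sup>L ?M f = measure lborel D / unit_parallelotope_volume \<eta>" .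
qed

section \<open>The mean of a local estimator on a parallelotope\<close>

definition hit_or_miss :: "(real ^ 'd::finite) set \<Rightarrow> real \<Rightarrow> (real ^ 'd) set \<Rightarrow> (real ^ 'd) set \<Rightarrow> (real ^ 'd) set" where
  "hit_or_miss X a B W = {x. (\<forall>b\<in>B. a *\<^sub>R (x + b) \<in> X) \<and> (\<forall>w\<in>W. a *\<^sub>R (x + w) \<notin> X)}"

lemma configuration_count_hit_or_miss:
  "configuration_count \<xi> BW a c X = card {z \<in> lattice_of \<xi>. z + c \<in> hit_or_miss X a (fst BW) (snd BW)}"
  unfolding configuration_count_def hit_or_miss_def
  by (rule arg_cong[of _ _ card]) (auto simp: scaleR_add_right add.assoc)

lemma hit_or_miss_borel_bounded:
  assumes X: "compact X" and a: "0 < a" and fin: "finite B" "finite W" and ne: "B \<noteq> {}"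
  shows "hit_or_miss X a B W \<in> sets borel" "bounded (hit_or_miss X a B W)"
proof -
  have [measurable]: "X \<in> sets borel" using X by (simp add: borel_compact)
  have "{x. \<forall>b\<in>B. a *\<^sub>R (x + b) \<in> X} \<in> sets borel" "{x. \<forall>w\<in>W. a *\<^sub>R (x + w) \<notin> X} \<in> sets borel"
    using fin by measurable
  then show "hit_or_miss X a B W \<in> sets borel"
    unfolding hit_or_miss_def Collect_conj_eq by (rule sets.Int)
  obtain b where b: "b \<in> B" using ne by blast
  obtain R where R: "\<And>x. x \<in> X \<Longrightarrow> norm x \<le> R"
    using compact_imp_bounded[OF X] by (auto simp: bounded_iff)
  show "bounded (hit_or_miss X a B W)"
    unfolding bounded_iff
  proof (intro exI ballI)
    fix x assume "x \<in> hit_or_miss X a B W"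
    then have "a * norm (x + b) \<le> R"
      using R[of "a *\<^sub>R (x + b)"] b a by (auto simp: hit_or_miss_def)
    then have "norm (x + b) \<le> R / a" using a by (simp add: field_simps)
    moreover have "norm x \<le> norm (x + b) + norm b"
      by (metis add_diff_cancel norm_triangle_ineq4)
    ultimately show "norm x \<le> R / a + norm b" by simp
  qed
qed

text \<open>Missing a further point \<open>w\<close> means removing the positions at which \<open>w\<close> is hit, so induction on \<open>W\<close>
  reduces everything to pure inclusion conditions.\<close>

lemma hit_or_miss_inclusion_exclusion:
  assumes X: "compact X" and a: "0 < a" and fin: "finite B" "finite W" and ne: "B \<noteq> {}"
  shows "measure lborel (hit_or_miss X a B W) =
    (\<Sum>S\<in>Pow W. (-1) ^ card S * measure lborel (hit_or_miss X a (B \<union> S) {}))"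
  using fin(2,1) ne
proof (induction W arbitrary: B rule: finite_induct)
  case empty
  then show ?case by simp
next
  case (insert w W)
  have meas: "hit_or_miss X a B' W' \<in> fmeasurable lborel" if "finite B'" "B' \<noteq> {}" "finite W'" for B' W'
    using hit_or_miss_borel_bounded[OF X a that(1,3,2)] emeasure_bounded_finite by (intro fmeasurableI) auto
  have "hit_or_miss X a B (insert w W) = hit_or_miss X a B W - hit_or_miss X a (insert w B) W"
    by (auto simp: hit_or_miss_def)
  moreover have "hit_or_miss X a (insert w B) W \<subseteq> hit_or_miss X a B W"
    by (auto simp: hit_or_miss_def)
  moreover have "hit_or_miss X a B W \<in> fmeasurable lborel" "hit_or_miss X a (insert w B) W \<in> sets lborel"
    using insert by (intro meas fmeasurableD; simp)+
  ultimately have "measure lborel (hit_or_miss X a B (insert w W)) =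
      measure lborel (hit_or_miss X a B W) - measure lborel (hit_or_miss X a (insert w B) W)"
    by (simp only: measurable_measure_Diff)
  also have "\<dots> = (\<Sum>S\<in>Pow W. (-1) ^ card S * measure lborel (hit_or_miss X a (B \<union> S) {})) -
      (\<Sum>S\<in>Pow W. (-1) ^ card S * measure lborel (hit_or_miss X a (insert w B \<union> S) {}))"
    using insert.IH[of B] insert.IH[of "insert w B"] insert.prems by simp
  also have "(\<Sum>S\<in>Pow W. (-1) ^ card S * measure lborel (hit_or_miss X a (insert w B \<union> S) {})) =
      - (\<Sum>S\<in>Pow W. (-1) ^ card (insert w S) * measure lborel (hit_or_miss X a (B \<union> insert w S) {}))"
    unfolding sum_negf[symmetric]
  proof (intro sum.cong refl)
    fix S assume "S \<in> Pow W"
    then have "card (insert w S) = Suc (card S)"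
      using insert.hyps finite_subset by (subst card_insert_disjoint) auto
    then show "(-1) ^ card S * measure lborel (hit_or_miss X a (insert w B \<union> S) {}) =
        - ((-1) ^ card (insert w S) * measure lborel (hit_or_miss X a (B \<union> insert w S) {}))"
      by simp
  qed
  finally show ?case
    by (simp add: sum_Pow_insert[OF insert.hyps(1,2)])
qed

definition width :: "'a::real_inner set \<Rightarrow> 'a \<Rightarrow> real" where
  "width T v = Max ((\<bullet>) v ` T) - Min ((\<bullet>) v ` T)"

text \<open>Keeping all translates of \<open>T\<close> inside the parallelotope shortens the slab with normal \<open>u i\<close> by the
  width of \<open>T\<close> in direction \<open>u i\<close>, so the admissible positions again form a parallelotope.\<close>

lemma hit_parallelotope_measure:
  fixes u e :: "'d::finite \<Rightarrow> real ^ 'd"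
  assumes dual: "dual_families u e" and T: "finite T" "T \<noteq> {}" and a: "0 < a"
    and small: "\<And>i. a * width T (u i) \<le> H i"
  shows "measure lborel (hit_or_miss (parallelotope u H) a T {}) =
    (\<Prod>i\<in>UNIV. H i / a - width T (u i)) * unit_parallelotope_volume u"
proof -
  let ?\<alpha> = "\<lambda>i. - Min ((\<bullet>) (u i) ` T)" and ?\<beta> = "\<lambda>i. H i / a - Max ((\<bullet>) (u i) ` T)"
  have "hit_or_miss (parallelotope u H) a T {} = {x. \<forall>i. ?\<alpha> i \<le> u i \<bullet> x \<and> u i \<bullet> x \<le> ?\<beta> i}"
  proof -
    have lower: "(\<forall>b\<in>T. 0 \<le> u i \<bullet> (a *\<^sub>R (x + b))) \<longleftrightarrow> ?\<alpha> i \<le> u i \<bullet> x" for x i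
    proof -
      have "(\<forall>b\<in>T. 0 \<le> u i \<bullet> (a *\<^sub>R (x + b))) \<longleftrightarrow> (\<forall>b\<in>T. - (u i \<bullet> x) \<le> u i \<bullet> b)"
        using a by (intro ball_cong refl) (auto simp: inner_add_right zero_le_mult_iff)
      also have "\<dots> \<longleftrightarrow> - (u i \<bullet> x) \<le> Min ((\<bullet>) (u i) ` T)"
        using T by simp
      finally show ?thesis by linarith
    qed
    have upper: "(\<forall>b\<in>T. u i \<bullet> (a *\<^sub>R (x + b)) \<le> H i) \<longleftrightarrow> u i \<bullet> x \<le> ?\<beta> i" for x i
    proof -
      have "(\<forall>b\<in>T. u i \<bullet> (a *\<^sub>R (x + b)) \<le> H i) \<longleftrightarrow> (\<forall>b\<in>T. u i \<bullet> b \<le> H i / a - u i \<bullet> x)"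
        using a by (intro ball_cong refl) (auto simp: inner_add_right field_simps)
      also have "\<dots> \<longleftrightarrow> Max ((\<bullet>) (u i) ` T) \<le> H i / a - u i \<bullet> x"
        using T by simp
      finally show ?thesis by linarith
    qed
    show ?thesis
      unfolding lower[symmetric] upper[symmetric] hit_or_miss_def parallelotope_def by auto
  qed
  moreover have "?\<alpha> i \<le> ?\<beta> i" for i
    using small[of i] a by (simp add: width_def field_simps)
  ultimately have "measure lebesgue (hit_or_miss (parallelotope u H) a T {}) =
      (\<Prod>i\<in>UNIV. ?\<beta> i - ?\<alpha> i) * unit_parallelotope_volume u"
    by (simp only: slab_measure[OF dual])
  moreover have "hit_or_miss (parallelotope u H) a T {} \<in> sets borel"
    using hit_or_miss_borel_bounded(1)[OF _ a T(1) _ T(2), of "parallelotope u H" "{}"]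
      zonotope_compact_convex(1)[of e H] by (simp add: parallelotope_eq_zonotope[OF dual])
  ultimately show ?thesis
    by (simp add: width_def algebra_simps)
qed

lemma finite_cell_points:
  fixes \<xi> :: "'d::finite \<Rightarrow> real ^ 'd"
  shows "finite (cell_points \<xi> n)"
proof -
  have "cell_points \<xi> n \<subseteq> (\<lambda>k. \<Sum>i\<in>UNIV. real (k i) *\<^sub>R \<xi> i) ` (PiE UNIV (\<lambda>_. {..<n}))"
    by (auto simp: cell_points_def intro!: imageI)
  then show ?thesis
    by (rule finite_subset) (intro finite_imageI finite_PiE; simp)
qed

text \<open>A configuration is determined by its first component, so the empty one occurs only at \<open>0\<close>.\<close>

lemma configuration_enumeration_facts:
  fixes \<xi> :: "'d::finite \<Rightarrow> real ^ 'd"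
  assumes enum: "configuration_enumeration \<xi> n conf" and l: "l \<in> {1..2 ^ (n ^ CARD('d)) - 1}"
  shows "fst (conf l) \<noteq> {}" "fst (conf l) \<union> snd (conf l) = cell_points \<xi> (n :: nat)"
proof -
  let ?N = "2 ^ (n ^ CARD('d)) :: nat"
  have inj: "inj_on conf {0..<?N}" and im: "\<And>k. k < ?N \<Longrightarrow> conf k \<in> configurations \<xi> n"
    and c0: "fst (conf 0) = {}"
    using enum by (auto simp: configuration_enumeration_def bij_betw_def)
  have lN: "l < ?N" "l \<noteq> 0" using l by auto
  have union: "fst (conf k) \<union> snd (conf k) = cell_points \<xi> n" if "k < ?N" for k
    using im[OF that] by (auto simp: configurations_def split_beta)
  then show "fst (conf l) \<union> snd (conf l) = cell_points \<xi> n" using lN by blast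
  show "fst (conf l) \<noteq> {}"
  proof
    assume "fst (conf l) = {}"
    then have "conf l = conf 0"
      using union[of l] union[of 0] c0 lN by (auto simp: prod_eq_iff)
    then show False
      using inj lN by (auto simp: inj_on_def)
  qed
qed

text \<open>For small \<open>a\<close> no slab is shortened to a negative length, and then the formula is exact rather than
  asymptotic. It involves arbitrary weights only through a linear combination of products of slab
  lengths.\<close>

lemma mean_estimator_parallelotope:
  fixes \<xi> u e :: "'d::finite \<Rightarrow> real ^ 'd"
  assumes \<xi>: "dual_families \<eta> \<xi>" and enum: "configuration_enumeration \<xi> n conf"
    and dual: "dual_families u e" and H: "\<And>i. 0 < H i"
  shows "\<forall>\<^sub>F a in at_right 0. mean_estimator \<xi> n conf w a (parallelotope u H) =
    (\<Sum>l = 1..2 ^ (n ^ CARD('d)) - 1. w l a * (\<Sum>S\<in>Pow (snd (conf l)). (-1) ^ card S *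
       ((\<Prod>i\<in>UNIV. H i / a - width (fst (conf l) \<union> S) (u i)) * unit_parallelotope_volume u))) /
    unit_parallelotope_volume \<eta>"
proof -
  let ?P = "parallelotope u H" and ?M = "uniform_measure lborel (unit_cell \<xi>)"
  have "\<forall>\<^sub>F a in at_right 0. a * width T v \<le> h" if "0 < h" for T and v :: "real ^ 'd" and h
  proof -
    have "((\<lambda>a. a * width T v) \<longlongrightarrow> 0 * width T v) (at_right 0)"
      by (intro tendsto_intros)
    then have "\<forall>\<^sub>F a in at_right 0. a * width T v < h"
      using that by (intro order_tendstoD) auto
    then show ?thesis by (rule eventually_mono) simp
  qed
  then have "\<forall>\<^sub>F a in at_right 0. \<forall>T\<in>Pow (cell_points \<xi> n). \<forall>i\<in>UNIV. a * width T (u i) \<le> H i"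
    using H by (intro eventually_ball_finite ballI) (auto simp: finite_cell_points)
  moreover have "\<forall>\<^sub>F a in at_right (0 :: real). 0 < a"
    by (rule eventually_at_right_less)
  ultimately show ?thesis
  proof eventually_elim
    case (elim a)
    have compact: "compact ?P"
      by (simp add: parallelotope_eq_zonotope[OF dual] zonotope_compact_convex)
    have fin: "finite (fst (conf l))" "finite (snd (conf l))" if "l \<in> {1..2 ^ (n ^ CARD('d)) - 1}" for l
      using configuration_enumeration_facts(2)[OF enum that] finite_cell_points[of \<xi> n] by (metis finite_Un)+
    note hm = hit_or_miss_borel_bounded[OF compact elim(2) fin]
    have int: "integrable ?M (\<lambda>c. real (configuration_count \<xi> (conf l) a c ?P))"
      and mean: "integral\<^sup>L ?M (\<lambda>c. real (configuration_count \<xi> (conf l) a c ?P)) =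
        (\<Sum>S\<in>Pow (snd (conf l)). (-1) ^ card S *
          ((\<Prod>i\<in>UNIV. H i / a - width (fst (conf l) \<union> S) (u i)) * unit_parallelotope_volume u)) / unit_parallelotope_volume \<eta>"
      if l: "l \<in> {1..2 ^ (n ^ CARD('d)) - 1}" for l
    proof -
      have ne: "fst (conf l) \<noteq> {}" and un: "fst (conf l) \<union> snd (conf l) = cell_points \<xi> n"
        using configuration_enumeration_facts[OF enum l] by auto
      show "integrable ?M (\<lambda>c. real (configuration_count \<xi> (conf l) a c ?P))"
        unfolding configuration_count_hit_or_miss using l ne
        by (intro lattice_count_mean(1)[OF \<xi>] hm) auto
      have "measure lborel (hit_or_miss ?P a (fst (conf l)) (snd (conf l))) =
          (\<Sum>S\<in>Pow (snd (conf l)). (-1) ^ card S * measure lborel (hit_or_miss ?P a (fst (conf l) \<union> S) {}))"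
        using l ne by (intro hit_or_miss_inclusion_exclusion[OF compact elim(2)] fin)
      also have "\<dots> = (\<Sum>S\<in>Pow (snd (conf l)). (-1) ^ card S *
          ((\<Prod>i\<in>UNIV. H i / a - width (fst (conf l) \<union> S) (u i)) * unit_parallelotope_volume u))"
      proof (intro sum.cong refl)
        fix S assume S: "S \<in> Pow (snd (conf l))"
        then have sub: "fst (conf l) \<union> S \<in> Pow (cell_points \<xi> n)" using un by blast
        have "measure lborel (hit_or_miss ?P a (fst (conf l) \<union> S) {}) =
            (\<Prod>i\<in>UNIV. H i / a - width (fst (conf l) \<union> S) (u i)) * unit_parallelotope_volume u"
          using sub ne elim finite_subset[OF _ finite_cell_points[of \<xi> n]]
          by (intro hit_parallelotope_measure[OF dual]) auto
        then show "(-1) ^ card S * measure lborel (hit_or_miss ?P a (fst (conf l) \<union> S) {}) = (-1) ^ card S *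
          ((\<Prod>i\<in>UNIV. H i / a - width (fst (conf l) \<union> S) (u i)) * unit_parallelotope_volume u)" by simp
      qed
      finally show "integral\<^sup>L ?M (\<lambda>c. real (configuration_count \<xi> (conf l) a c ?P)) =
        (\<Sum>S\<in>Pow (snd (conf l)). (-1) ^ card S *
          ((\<Prod>i\<in>UNIV. H i / a - width (fst (conf l) \<union> S) (u i)) * unit_parallelotope_volume u)) / unit_parallelotope_volume \<eta>"
        unfolding configuration_count_hit_or_miss using l ne
        by (subst lattice_count_mean(2)[OF \<xi>]) (auto intro: hm)
    qed
    have "mean_estimator \<xi> n conf w a ?P = (\<Sum>l = 1..2 ^ (n ^ CARD('d)) - 1.
        integral\<^sup>L ?M (\<lambda>c. w l a * real (configuration_count \<xi> (conf l) a c ?P)))"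
      unfolding mean_estimator_def local_estimator_def
      by (intro Bochner_Integration.integral_sum integrable_mult_right int)
    also have "\<dots> = (\<Sum>l = 1..2 ^ (n ^ CARD('d)) - 1. w l a * (\<Sum>S\<in>Pow (snd (conf l)). (-1) ^ card S *
       ((\<Prod>i\<in>UNIV. H i / a - width (fst (conf l) \<union> S) (u i)) * unit_parallelotope_volume u))) /
        unit_parallelotope_volume \<eta>"
      unfolding sum_divide_distrib
    proof (intro sum.cong refl)
      fix l :: nat assume l: "l \<in> {1..2 ^ (n ^ CARD('d)) - 1}"
      show "integral\<^sup>L ?M (\<lambda>c. w l a * real (configuration_count \<xi> (conf l) a c ?P)) =
        w l a * (\<Sum>S\<in>Pow (snd (conf l)). (-1) ^ card S *
       ((\<Prod>i\<in>UNIV. H i / a - width (fst (conf l) \<union> S) (u i)) * unit_parallelotope_volume u)) / unit_parallelotope_volume \<eta>"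
        by (simp add: mean[OF l])
    qed
    finally show ?case .
  qed
qed

section \<open>Parallelotopes with nearly parallel facets\<close>

text \<open>The coefficient of \<open>\<Prod>i\<in>I. H i\<close> in the weighted sum over \<open>k\<close> of the products of shortened slab
  lengths. For each \<open>k\<close> it contains a product of widths in the directions \<open>u i\<close> with \<open>i \<notin> I\<close> only, which is
  symmetric in these directions.\<close>

definition width_coeff ::
  "'k set \<Rightarrow> (real \<Rightarrow> 'k \<Rightarrow> real) \<Rightarrow> ('k \<Rightarrow> (real ^ 'd) set) \<Rightarrow> 'd set \<Rightarrow> ('d::finite \<Rightarrow> real ^ 'd) \<Rightarrow> real \<Rightarrow> real" where
  "width_coeff K \<gamma> T I u a = (\<Sum>k\<in>K. \<gamma> a k * (1 / a) ^ card I * (\<Prod>i\<in>- I. - width (T k) (u i)))"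

lemma width_coeff_expansion:
  fixes u :: "'d::finite \<Rightarrow> real ^ 'd"
  shows "(\<Sum>k\<in>K. \<gamma> a k * (\<Prod>i\<in>UNIV. H i / a - width (T k) (u i))) =
    (\<Sum>I\<in>UNIV. width_coeff K \<gamma> T I u a * (\<Prod>i\<in>I. H i))"
proof -
  have "(\<Prod>i\<in>UNIV. H i / a - width (T k) (u i)) =
      (\<Sum>I\<in>UNIV. (1 / a) ^ card I * (\<Prod>i\<in>I. H i) * (\<Prod>i\<in>- I. - width (T k) (u i)))" for k
  proof -
    have "(\<Prod>i\<in>UNIV. H i / a - width (T k) (u i)) = (\<Prod>i\<in>UNIV. H i / a + - width (T k) (u i))"
      by simp
    also have "\<dots> = (\<Sum>I\<in>Pow UNIV. (\<Prod>i\<in>I. H i / a) * (\<Prod>i\<in>UNIV - I. - width (T k) (u i)))"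
      by (rule prod_add) simp
    also have "\<dots> = (\<Sum>I\<in>UNIV. (1 / a) ^ card I * (\<Prod>i\<in>I. H i) * (\<Prod>i\<in>- I. - width (T k) (u i)))"
      unfolding Pow_UNIV Compl_eq_Diff_UNIV by (intro sum.cong refl) (simp add: prod_dividef power_one_over)
    finally show ?thesis .
  qed
  then have "(\<Sum>k\<in>K. \<gamma> a k * (\<Prod>i\<in>UNIV. H i / a - width (T k) (u i))) =
      (\<Sum>k\<in>K. \<Sum>I\<in>UNIV. \<gamma> a k * ((1 / a) ^ card I * (\<Prod>i\<in>I. H i) * (\<Prod>i\<in>- I. - width (T k) (u i))))"
    by (simp only: sum_distrib_left)
  also have "\<dots> = (\<Sum>I\<in>UNIV. \<Sum>k\<in>K. \<gamma> a k * ((1 / a) ^ card I * (\<Prod>i\<in>I. H i) * (\<Prod>i\<in>- I. - width (T k) (u i))))"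
    by (rule sum.swap)
  also have "\<dots> = (\<Sum>I\<in>UNIV. width_coeff K \<gamma> T I u a * (\<Prod>i\<in>I. H i))"
    unfolding width_coeff_def sum_distrib_right by (intro sum.cong refl) (simp only: mult_ac)
  finally show ?thesis .
qed

lemma width_coeff_additive:
  fixes u :: "'d::finite \<Rightarrow> real ^ 'd"
  assumes "j \<notin> I" and add: "\<And>k. k \<in> K \<Longrightarrow> width (T k) (x + \<epsilon> *\<^sub>R y) = width (T k) x + \<epsilon> * width (T k) y"
  shows "width_coeff K \<gamma> T I (u(j := x + \<epsilon> *\<^sub>R y)) a =
    width_coeff K \<gamma> T I (u(j := x)) a + \<epsilon> * width_coeff K \<gamma> T I (u(j := y)) a"
proof -
  have split: "(\<Prod>i\<in>- I. - width (T k) ((u(j := v)) i)) = - width (T k) v * (\<Prod>i\<in>- I - {j}. - width (T k) (u i))" for k v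
  proof -
    have "(\<Prod>i\<in>- I. - width (T k) ((u(j := v)) i)) =
        - width (T k) ((u(j := v)) j) * (\<Prod>i\<in>- I - {j}. - width (T k) ((u(j := v)) i))"
      using assms(1) by (intro prod.remove) auto
    also have "(\<Prod>i\<in>- I - {j}. - width (T k) ((u(j := v)) i)) = (\<Prod>i\<in>- I - {j}. - width (T k) (u i))"
      by (intro prod.cong) auto
    finally show ?thesis by simp
  qed
  show ?thesis
    unfolding width_coeff_def split sum_distrib_left sum.distrib[symmetric]
    by (intro sum.cong refl) (simp add: add algebra_simps)
qed

lemma width_coeff_swap:
  fixes u :: "'d::finite \<Rightarrow> real ^ 'd"
  assumes ij: "i \<notin> I" "j \<notin> I" "i \<noteq> j"
  shows "width_coeff K \<gamma> T I (u(i := u j, j := u i)) a = width_coeff K \<gamma> T I u a"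
proof -
  have split: "(\<Prod>m\<in>- I. - width (T k) (v m)) =
      width (T k) (v i) * width (T k) (v j) * (\<Prod>m\<in>- I - {i} - {j}. - width (T k) (v m))"
    for k and v :: "'d \<Rightarrow> real ^ 'd"
    using ij prod.remove[of "- I" i "\<lambda>m. - width (T k) (v m)"]
      prod.remove[of "- I - {i}" j "\<lambda>m. - width (T k) (v m)"] by simp
  have "(\<Prod>m\<in>- I - {i} - {j}. - width (T k) ((u(i := u j, j := u i)) m)) =
      (\<Prod>m\<in>- I - {i} - {j}. - width (T k) (u m))" for k
    by (intro prod.cong) auto
  then show ?thesis
    unfolding width_coeff_def split[of _ "u(i := u j, j := u i)"] split[of _ u]
    using ij(3) by (simp add: mult.commute mult.left_commute)
qed

text \<open>Tilting one facet normal towards another one changes only two dual edges. Combined with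
  \<open>zonotope_coeff_local\<close>, the coefficients at sets \<open>I\<close> that avoid \<open>i\<close> and \<open>j\<close> stay the same.\<close>

lemma dual_families_update:
  assumes dual: "dual_families u e" and ij: "i \<noteq> j" and \<epsilon>: "\<epsilon> \<noteq> 0"
  shows "dual_families (u(j := u i + \<epsilon> *\<^sub>R u j)) (e(i := e i - (1 / \<epsilon>) *\<^sub>R e j, j := (1 / \<epsilon>) *\<^sub>R e j))"
proof -
  have d: "u k \<bullet> e m = (if k = m then 1 else 0)" for k m
    using dual by (simp add: dual_families_def)
  show ?thesis
    unfolding dual_families_def
    using ij \<epsilon> by (auto simp: inner_add_left inner_diff_right d)
qed

text \<open>With \<open>u j\<close> replaced by a vector at distance of order \<open>\<epsilon>\<close> from \<open>u i\<close>, the parallelotope becomes long in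
  one direction: it contains the one with normals \<open>u\<close> and side lengths \<open>1 / 2\<close>, \<open>1 / (2 * \<epsilon>)\<close> and \<open>1\<close>.\<close>

lemma unit_parallelotope_volume_update:
  fixes u e :: "'d::finite \<Rightarrow> real ^ 'd"
  assumes dual: "dual_families u e" and ij: "i \<noteq> j" and \<epsilon>: "0 < \<epsilon>"
  shows "unit_parallelotope_volume u / (4 * \<epsilon>) \<le> unit_parallelotope_volume (u(j := u i + \<epsilon> *\<^sub>R u j))"
proof -
  \<comment> \<open>These sides have product \<open>1 / (4 * \<epsilon>)\<close> and satisfy \<open>s i + \<epsilon> * s j = 1\<close>.\<close>
  define s where "s k = (if k = i then 1 / 2 else if k = j then 1 / (2 * \<epsilon>) else 1)" for k
  let ?u = "u(j := u i + \<epsilon> *\<^sub>R u j)"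
  have s: "0 \<le> s k" for k using \<epsilon> by (simp add: s_def)
  obtain e' where dual': "dual_families ?u e'"
    using dual_families_update[OF dual ij, of \<epsilon>] \<epsilon> by blast
  have "(\<Prod>k\<in>UNIV. s k) = s i * (\<Prod>k\<in>UNIV - {i}. s k)"
    by (rule prod.remove) auto
  also have "(\<Prod>k\<in>UNIV - {i}. s k) = s j * (\<Prod>k\<in>UNIV - {i} - {j}. s k)"
    using ij by (intro prod.remove) auto
  also have "(\<Prod>k\<in>UNIV - {i} - {j}. s k) = 1"
    by (intro prod.neutral) (auto simp: s_def)
  finally have "(\<Prod>k\<in>UNIV. s k) = 1 / (4 * \<epsilon>)"
    using ij by (simp add: s_def)
  then have "unit_parallelotope_volume u / (4 * \<epsilon>) = measure lebesgue (parallelotope u s)"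
    using zonotope_measure[OF dual s] by (simp add: parallelotope_eq_zonotope[OF dual])
  also have "\<dots> \<le> measure lebesgue (parallelotope ?u (\<lambda>_. 1))"
  proof (rule measure_mono_fmeasurable)
    show "parallelotope u s \<subseteq> parallelotope ?u (\<lambda>_. 1)"
    proof
      fix x assume "x \<in> parallelotope u s"
      then have b: "0 \<le> u k \<bullet> x" "u k \<bullet> x \<le> s k" for k
        by (auto simp: parallelotope_def)
      have "s k \<le> 1" if "k \<noteq> j" for k
        using that by (simp add: s_def)
      then have "0 \<le> ?u k \<bullet> x \<and> ?u k \<bullet> x \<le> 1" if "k \<noteq> j" for k
        using b[of k] that order_trans by fastforce
      moreover have "0 \<le> ?u j \<bullet> x \<and> ?u j \<bullet> x \<le> 1"
      proof -
        have "\<epsilon> * (u j \<bullet> x) \<le> \<epsilon> * (1 / (2 * \<epsilon>))"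
          using b[of j] \<epsilon> ij by (intro mult_left_mono) (auto simp: s_def)
        then have "\<epsilon> * (u j \<bullet> x) \<le> 1 / 2" using \<epsilon> by simp
        moreover have "u i \<bullet> x \<le> 1 / 2" using b(2)[of i] by (simp add: s_def)
        moreover have "0 \<le> \<epsilon> * (u j \<bullet> x)" using b(1)[of j] \<epsilon> by simp
        ultimately show ?thesis
          using b(1)[of i] by (simp add: inner_add_left)
      qed
      ultimately have "0 \<le> ?u k \<bullet> x \<and> ?u k \<bullet> x \<le> 1" for k
        by (cases "k = j") blast+
      then show "x \<in> parallelotope ?u (\<lambda>_. 1)"
        unfolding parallelotope_def by blast
    qed
    show "parallelotope u s \<in> sets lebesgue" "parallelotope ?u (\<lambda>_. 1) \<in> lmeasurable"
      by (simp_all only: parallelotope_eq_zonotope[OF dual] parallelotope_eq_zonotope[OF dual']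
          lmeasurable_compact zonotope_compact_convex fmeasurableD)
  qed
  finally show ?thesis by (simp add: unit_parallelotope_volume_def)
qed

text \<open>On such a cone of directions all widths are additive, so that the coefficients above behave like
  symmetric multilinear forms.\<close>

locale width_cone =
  fixes U :: "(real ^ 'd::finite) set" and K :: "'k set" and T :: "'k \<Rightarrow> (real ^ 'd) set"
  assumes cone: "\<And>x y \<epsilon>. x \<in> U \<Longrightarrow> y \<in> U \<Longrightarrow> 0 < \<epsilon> \<Longrightarrow> x + \<epsilon> *\<^sub>R y \<in> U"
    and additive: "\<And>k x y \<epsilon>. k \<in> K \<Longrightarrow> x \<in> U \<Longrightarrow> y \<in> U \<Longrightarrow> 0 < \<epsilon> \<Longrightarrow>
      width (T k) (x + \<epsilon> *\<^sub>R y) = width (T k) x + \<epsilon> * width (T k) y"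
begin

text \<open>Write \<open>b(x, y)\<close> for the limit with \<open>x\<close> and \<open>y\<close> at the places \<open>i\<close> and \<open>j\<close>. Replacing \<open>u j\<close> by
  \<open>u i + \<epsilon> *\<^sub>R u j\<close> leaves the right side of the bound unchanged while the volume factor on the left grows
  like \<open>1 / \<epsilon>\<close>. So \<open>b(u i, u i) + \<epsilon> * b(u i, u j)\<close> is of order \<open>\<epsilon>\<close>, which forces \<open>b(u i, u i) = 0\<close>.\<close>

lemma coefficient_diagonal:
  fixes u e :: "'d \<Rightarrow> real ^ 'd" and \<gamma> :: "real \<Rightarrow> 'k \<Rightarrow> real"
  assumes bound: "\<And>u e. dual_families u e \<Longrightarrow> \<exists>\<alpha>. (width_coeff K \<gamma> T I u \<longlongrightarrow> \<alpha>) (at_right 0) \<and>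
        \<bar>unit_parallelotope_volume u * \<alpha>\<bar> \<le> M * zonotope_coeff e I"
    and dual: "dual_families u e" and U: "\<And>k. u k \<in> U"
    and ij: "i \<notin> I" "j \<notin> I" "i \<noteq> j"
  shows "(width_coeff K \<gamma> T I (u(j := u i)) \<longlongrightarrow> 0) (at_right 0)"
proof -
  let ?c = "width_coeff K \<gamma> T I" and ?p = unit_parallelotope_volume
  obtain \<alpha> where \<alpha>: "(?c u \<longlongrightarrow> \<alpha>) (at_right 0)"
    using bound[OF dual] by blast
  let ?u = "\<lambda>\<epsilon>. u(j := u i + \<epsilon> *\<^sub>R u j)"
  have add: "?c (?u \<epsilon>) a = ?c (u(j := u i)) a + \<epsilon> * ?c u a" if "0 < \<epsilon>" for \<epsilon> a
  proof -
    have "?c (u(j := u i + \<epsilon> *\<^sub>R u j)) a = ?c (u(j := u i)) a + \<epsilon> * ?c (u(j := u j)) a"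
      by (rule width_coeff_additive[OF ij(2)]) (use additive U that in auto)
    then show ?thesis by simp
  qed
  have pert: "\<exists>\<beta>. (?c (?u \<epsilon>) \<longlongrightarrow> \<beta>) (at_right 0) \<and> ?p (?u \<epsilon>) * \<bar>\<beta>\<bar> \<le> M * zonotope_coeff e I"
    if \<epsilon>: "0 < \<epsilon>" for \<epsilon>
  proof -
    let ?e = "e(i := e i - (1 / \<epsilon>) *\<^sub>R e j, j := (1 / \<epsilon>) *\<^sub>R e j)"
    have d: "dual_families (?u \<epsilon>) ?e"
      using \<epsilon> by (intro dual_families_update[OF dual ij(3)]) simp
    have "zonotope_coeff ?e I = zonotope_coeff e I"
      using ij by (intro zonotope_coeff_local) auto
    with bound[OF d] unit_parallelotope_volume_pos[OF d] show ?thesis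
      by (simp add: abs_mult)
  qed
  obtain \<beta>1 where \<beta>1: "(?c (?u 1) \<longlongrightarrow> \<beta>1) (at_right 0)" using pert[of 1] by auto
  define \<beta> where "\<beta> = \<beta>1 - \<alpha>"
  have \<beta>: "(?c (u(j := u i)) \<longlongrightarrow> \<beta>) (at_right 0)"
  proof -
    have "?c (u(j := u i)) = (\<lambda>a. ?c (?u 1) a - ?c u a)"
      using add[of 1] by auto
    then show ?thesis
      unfolding \<beta>_def using tendsto_diff[OF \<beta>1 \<alpha>] by simp
  qed
  \<comment> \<open>The factor \<open>4\<close> comes from the lower bound for the volume of the tilted parallelotope.\<close>
  define B where "B = 4 * (M * zonotope_coeff e I) / ?p u + \<bar>\<alpha>\<bar>"
  have p: "0 < ?p u" by (rule unit_parallelotope_volume_pos[OF dual])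
  have small: "\<bar>\<beta>\<bar> \<le> \<epsilon> * B" if \<epsilon>: "0 < \<epsilon>" for \<epsilon>
  proof -
    obtain \<beta>' where \<beta>': "(?c (?u \<epsilon>) \<longlongrightarrow> \<beta>') (at_right 0)" "?p (?u \<epsilon>) * \<bar>\<beta>'\<bar> \<le> M * zonotope_coeff e I"
      using pert[OF \<epsilon>] by blast
    have "?c (?u \<epsilon>) = (\<lambda>a. ?c (u(j := u i)) a + \<epsilon> * ?c u a)"
      using add[OF \<epsilon>] by auto
    then have "(?c (?u \<epsilon>) \<longlongrightarrow> \<beta> + \<epsilon> * \<alpha>) (at_right 0)"
      using tendsto_add[OF \<beta> tendsto_mult_left[OF \<alpha>]] by simp
    then have eq: "\<beta>' = \<beta> + \<epsilon> * \<alpha>"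
      using \<beta>'(1) by (intro tendsto_unique[OF trivial_limit_at_right_real])
    have "?p u / (4 * \<epsilon>) * \<bar>\<beta>'\<bar> \<le> ?p (?u \<epsilon>) * \<bar>\<beta>'\<bar>"
      by (intro mult_right_mono unit_parallelotope_volume_update[OF dual ij(3) \<epsilon>]) simp
    also note \<beta>'(2)
    finally have "\<bar>\<beta>'\<bar> \<le> \<epsilon> * (4 * (M * zonotope_coeff e I) / ?p u)"
      using p \<epsilon> by (simp add: field_simps)
    moreover have "\<bar>\<beta>\<bar> \<le> \<bar>\<beta>'\<bar> + \<epsilon> * \<bar>\<alpha>\<bar>"
    proof -
      have "\<bar>\<epsilon> * \<alpha>\<bar> = \<epsilon> * \<bar>\<alpha>\<bar>" using \<epsilon> by (simp add: abs_mult)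
      then show ?thesis unfolding eq by linarith
    qed
    ultimately show ?thesis by (simp add: B_def algebra_simps)
  qed
  have "\<beta> = 0"
  proof (rule ccontr)
    assume "\<beta> \<noteq> 0"
    have "0 < B" using small[of 1] \<open>\<beta> \<noteq> 0\<close> by simp
    then have "\<bar>\<beta>\<bar> \<le> \<bar>\<beta>\<bar> / 2"
      using small[of "\<bar>\<beta>\<bar> / (2 * B)"] \<open>\<beta> \<noteq> 0\<close> by simp
    then show False using \<open>\<beta> \<noteq> 0\<close> by simp
  qed
  with \<beta> show ?thesis by simp
qed

text \<open>Polarization: the symmetric form \<open>b\<close> vanishes on the diagonal at \<open>u i\<close>, at \<open>u j\<close> and at \<open>u i + u j\<close>,
  hence \<open>2 * b(u i, u j) = 0\<close>.\<close>

lemma coefficient_vanishes: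
  fixes u e :: "'d \<Rightarrow> real ^ 'd" and \<gamma> :: "real \<Rightarrow> 'k \<Rightarrow> real"
  assumes bound: "\<And>u e. dual_families u e \<Longrightarrow> \<exists>\<alpha>. (width_coeff K \<gamma> T I u \<longlongrightarrow> \<alpha>) (at_right 0) \<and>
        \<bar>unit_parallelotope_volume u * \<alpha>\<bar> \<le> M * zonotope_coeff e I"
    and dual: "dual_families u e" and U: "\<And>k. u k \<in> U"
    and ij: "i \<notin> I" "j \<notin> I" "i \<noteq> j"
  shows "(width_coeff K \<gamma> T I u \<longlongrightarrow> 0) (at_right 0)"
proof -
  let ?c = "width_coeff K \<gamma> T I" and ?x = "u i" and ?y = "u j"
  let ?z = "?x + 1 *\<^sub>R ?y"
  have z: "?z \<in> U" using U by (intro cone) auto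
  have xx: "(?c (u(j := ?x)) \<longlongrightarrow> 0) (at_right 0)"
    using ij by (intro coefficient_diagonal[OF bound dual U])
  have yy: "(?c (u(i := ?y)) \<longlongrightarrow> 0) (at_right 0)"
    using ij by (intro coefficient_diagonal[OF bound dual U]) auto
  have zz: "(?c (u(i := ?z, j := ?z)) \<longlongrightarrow> 0) (at_right 0)"
  proof -
    let ?u = "u(i := ?z)"
    have eq: "?u = u(i := ?y + 1 *\<^sub>R ?x)" by (simp add: add.commute)
    obtain e' where d: "dual_families ?u e'"
      unfolding eq using dual_families_update[OF dual, of j i 1] ij by auto
    have "(?c (?u(j := ?u i)) \<longlongrightarrow> 0) (at_right 0)"
      by (rule coefficient_diagonal[OF bound d _ ij]) (use U z in auto)
    then show ?thesis by (simp only: fun_upd_same)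
  qed
  have add: "?c (v(m := ?z)) a = ?c (v(m := ?x)) a + ?c (v(m := ?y)) a" if "m \<notin> I" for v m a
  proof -
    have "?c (v(m := ?z)) a = ?c (v(m := ?x)) a + 1 * ?c (v(m := ?y)) a"
      by (rule width_coeff_additive[OF that], rule additive) (use U in auto)
    then show ?thesis by simp
  qed
  have double: "2 * ?c u a = ?c (u(i := ?z, j := ?z)) a - ?c (u(j := ?x)) a - ?c (u(i := ?y)) a" for a
  proof -
    have upd: "u(i := v, j := v') = u(j := v', i := v)" for v v' :: "real ^ 'd"
      using ij(3) by (rule fun_upd_twist)
    have "?c (u(i := ?z, j := ?z)) a = ?c (u(i := ?z, j := ?x)) a + ?c (u(i := ?z, j := ?y)) a"
      by (rule add[OF ij(2)])
    also have "?c (u(i := ?z, j := ?x)) a = ?c (u(i := ?x, j := ?x)) a + ?c (u(i := ?y, j := ?x)) a"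
      unfolding upd by (rule add[OF ij(1)])
    also have "?c (u(i := ?z, j := ?y)) a = ?c (u(i := ?x, j := ?y)) a + ?c (u(i := ?y, j := ?y)) a"
      unfolding upd by (rule add[OF ij(1)])
    also have "?c (u(i := ?y, j := ?x)) a = ?c u a"
      by (rule width_coeff_swap[OF ij])
    also have "u(i := ?x, j := ?x) = u(j := ?x)" by simp
    also have "u(i := ?x, j := ?y) = u" by simp
    also have "u(i := ?y, j := ?y) = u(i := ?y)" unfolding upd by simp
    finally show ?thesis by linarith
  qed
  have "?c u = (\<lambda>a. (1 / 2) * (?c (u(i := ?z, j := ?z)) a - ?c (u(j := ?x)) a - ?c (u(i := ?y)) a))"
    unfolding double[symmetric] by simp
  moreover have "((\<lambda>a. (1 / 2) * (?c (u(i := ?z, j := ?z)) a - ?c (u(j := ?x)) a - ?c (u(i := ?y)) a)) \<longlongrightarrow> 0) (at_right 0)"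
    using tendsto_mult_left[OF tendsto_diff[OF tendsto_diff[OF zz xx] yy], of "1 / 2"] by simp
  ultimately show ?thesis by simp
qed

end

section \<open>A cone of directions with linear widths\<close>

lemma dual_families_of_independent:
  fixes u :: "'d::finite \<Rightarrow> real ^ 'd"
  assumes "\<And>c. (\<Sum>i\<in>UNIV. c i *\<^sub>R u i) = 0 \<Longrightarrow> \<forall>i. c i = 0"
  obtains e where "dual_families u e"
proof (rule dual_families_exist)
  have "\<exists>B. (\<chi> i. u i) ** B = mat 1"
    unfolding matrix_right_invertible_independent_rows
    using assms by (simp add: row_def scalar_mult_eq_scaleR)
  then show "det (\<chi> i. u i) \<noteq> 0"
    using invertible_det_nz invertible_right_inverse by blast
qed

text \<open>The directions that fail to separate two given points form a hyperplane, and finitely many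
  hyperplanes do not cover the space.\<close>

lemma generic_direction:
  fixes C :: "(real ^ 'd::finite) set"
  assumes "finite C"
  obtains v where "inj_on ((\<bullet>) v) C"
proof -
  let ?N = "\<Union>(b, b')\<in>{(b, b'). b \<in> C \<and> b' \<in> C \<and> b \<noteq> b'}. {v. (b - b') \<bullet> v = 0}"
  have "finite {(b, b'). b \<in> C \<and> b' \<in> C \<and> b \<noteq> b'}"
    by (rule finite_subset[of _ "C \<times> C"]) (use assms in auto)
  then have "negligible ?N"
    by (intro negligible_Union) (auto intro!: negligible_hyperplane)
  then have "?N \<noteq> UNIV"
    by (rule contrapos_pn) (simp only: non_negligible_UNIV not_False_eq_True)
  then obtain v where v: "v \<notin> ?N"
    by blast
  have "inj_on ((\<bullet>) v) C"
  proof (rule inj_onI, rule ccontr)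
    fix b b' assume "b \<in> C" "b' \<in> C" "v \<bullet> b = v \<bullet> b'" "b \<noteq> b'"
    then show False using v by (auto simp: inner_diff_right inner_commute)
  qed
  then show ?thesis by (rule that)
qed

text \<open>All directions that order \<open>C\<close> in the same way attain their extrema over \<open>T\<close> at the same two points,
  and \<open>p\<close> is the difference of these points.\<close>

lemma width_linear_on_order_cone:
  fixes C :: "(real ^ 'd::finite) set"
  assumes inj: "inj_on ((\<bullet>) v0) C" and T: "T \<subseteq> C" "finite T" "T \<noteq> {}"
  shows "\<exists>p. \<forall>v. (\<forall>b\<in>C. \<forall>b'\<in>C. v0 \<bullet> b < v0 \<bullet> b' \<longrightarrow> v \<bullet> b < v \<bullet> b') \<longrightarrow> width T v = v \<bullet> p"
proof -
  have "Max ((\<bullet>) v0 ` T) \<in> (\<bullet>) v0 ` T" "Min ((\<bullet>) v0 ` T) \<in> (\<bullet>) v0 ` T"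
    using T by (auto intro!: Max_in Min_in)
  then obtain b1 b2 where b: "b1 \<in> T" "b2 \<in> T" "Max ((\<bullet>) v0 ` T) = v0 \<bullet> b1" "Min ((\<bullet>) v0 ` T) = v0 \<bullet> b2"
    by auto
  have le0: "v0 \<bullet> b \<le> v0 \<bullet> b1" "v0 \<bullet> b2 \<le> v0 \<bullet> b" if "b \<in> T" for b
    using T(2) that unfolding b(3,4)[symmetric] by auto
  have "width T v = v \<bullet> (b1 - b2)"
    if v: "\<forall>b\<in>C. \<forall>b'\<in>C. v0 \<bullet> b < v0 \<bullet> b' \<longrightarrow> v \<bullet> b < v \<bullet> b'" for v
  proof -
    have mono: "v \<bullet> b \<le> v \<bullet> b'" if "b \<in> T" "b' \<in> T" "v0 \<bullet> b \<le> v0 \<bullet> b'" for b b'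
    proof (cases "b = b'")
      case False
      then have "v0 \<bullet> b \<noteq> v0 \<bullet> b'" using inj that T(1) by (auto simp: inj_on_def)
      with that have "v0 \<bullet> b < v0 \<bullet> b'" by simp
      then show ?thesis using v that T(1) by (meson less_imp_le subsetD)
    qed simp
    have "Max ((\<bullet>) v ` T) = v \<bullet> b1"
      using T(2) b(1) mono[OF _ b(1) le0(1)] by (intro Max_eqI) auto
    moreover have "Min ((\<bullet>) v ` T) = v \<bullet> b2"
      using T(2) b(2) mono[OF b(2) _ le0(2)] by (intro Min_eqI) auto
    ultimately show ?thesis by (simp add: width_def inner_diff_right)
  qed
  then show ?thesis by blast
qed

text \<open>The directions that order the points of \<open>C\<close> like a generic direction \<open>v0\<close> form an open cone. Small
  multiples of the coordinate vectors added to \<open>v0\<close> stay in it and are linearly independent for all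
  positive multiples but at most one.\<close>

lemma width_cone_exists:
  fixes T :: "'k \<Rightarrow> (real ^ 'd::finite) set"
  assumes C: "finite C" and T: "\<And>k. k \<in> K \<Longrightarrow> T k \<subseteq> C \<and> T k \<noteq> {}"
  obtains U u e where "width_cone U K T" "dual_families u e" "\<And>i. u i \<in> U"
proof -
  obtain v0 where inj: "inj_on ((\<bullet>) v0) C" using generic_direction[OF C] by blast
  define U where "U = {v. \<forall>b\<in>C. \<forall>b'\<in>C. v0 \<bullet> b < v0 \<bullet> b' \<longrightarrow> v \<bullet> b < v \<bullet> b'}"
  have lin: "x + \<epsilon> *\<^sub>R y \<in> U" if "x \<in> U" "y \<in> U" "0 < \<epsilon>" for x y \<epsilon>
    using that unfolding U_def by (auto simp: inner_add_left intro!: add_strict_mono)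
  have cone: "width_cone U K T"
  proof
    fix k x y and \<epsilon> :: real assume k: "k \<in> K" and xy: "x \<in> U" "y \<in> U" "0 < \<epsilon>"
    obtain p where p: "\<And>v. v \<in> U \<Longrightarrow> width (T k) v = v \<bullet> p"
      using width_linear_on_order_cone[OF inj, of "T k"] T[OF k] finite_subset[OF _ C, of "T k"]
      unfolding U_def by auto
    show "width (T k) (x + \<epsilon> *\<^sub>R y) = width (T k) x + \<epsilon> * width (T k) y"
      using p[OF xy(1)] p[OF xy(2)] p[OF lin[OF xy]] by (simp add: inner_add_left)
  qed (rule lin)
  have "open U"
  proof -
    have "U = (\<Inter>b\<in>C. \<Inter>b'\<in>{b' \<in> C. v0 \<bullet> b < v0 \<bullet> b'}. {v. (b - b') \<bullet> v < 0})"
      by (auto simp: U_def inner_diff_right inner_commute)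
    moreover have "open \<dots>"
      using C by (intro open_INT ballI open_halfspace_lt) auto
    ultimately show ?thesis by simp
  qed
  moreover have "v0 \<in> U" by (simp add: U_def)
  ultimately obtain r where r: "0 < r" "cball v0 r \<subseteq> U"
    using open_contains_cball by blast
  define S where "S = (\<Sum>i\<in>UNIV. v0 $ i)"
  obtain \<delta> where \<delta>: "0 < \<delta>" "\<delta> \<le> r" "\<delta> + S \<noteq> 0"
  proof (cases "r + S = 0")
    case True
    then show ?thesis using that[of "r / 2"] r by simp
  next
    case False
    then show ?thesis using that[of r] r by simp
  qed
  define u where "u i = v0 + \<delta> *\<^sub>R axis i 1" for i
  have "u i \<in> U" for i
    using r(2) \<delta> by (auto simp: u_def dist_norm intro!: subsetD[OF r(2)])
  moreover obtain e where "dual_families u e"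
  proof (rule dual_families_of_independent)
    fix c assume c: "(\<Sum>i\<in>UNIV. c i *\<^sub>R u i) = 0"
    let ?s = "\<Sum>i\<in>UNIV. c i"
    have comp: "?s * v0 $ k + \<delta> * c k = 0" for k
    proof -
      have "(\<Sum>i\<in>UNIV. c i * (axis i (1 :: real) :: real ^ 'd) $ k) = (\<Sum>i\<in>UNIV. if i = k then c i else 0)"
        by (intro sum.cong) (auto simp: axis_def)
      then have "(\<Sum>i\<in>UNIV. c i *\<^sub>R u i) $ k = ?s * v0 $ k + \<delta> * c k"
        by (simp add: u_def algebra_simps sum.distrib sum_distrib_left sum_distrib_right) (simp add: sum_distrib_left[symmetric] mult.left_commute[of _ \<delta>])
      then show ?thesis using c by simp
    qed
    have "(\<Sum>k\<in>UNIV. ?s * v0 $ k + \<delta> * c k) = ?s * S + \<delta> * ?s"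
      by (simp only: sum.distrib sum_distrib_left[symmetric] S_def)
    then have "?s * (\<delta> + S) = 0"
      by (simp only: comp sum.neutral_const) (simp add: algebra_simps)
    then have "?s = 0" using \<delta>(3) by simp
    then show "\<forall>i. c i = 0" using comp \<delta>(1) by simp
  qed
  ultimately show ?thesis using that cone by blast
qed

section \<open>The asymptotic bias\<close>

theorem theorem1p3:
  fixes \<xi> :: "'d::finite \<Rightarrow> real ^ 'd"
    and q n :: nat
    and conf :: "nat \<Rightarrow> 'd configuration"
    and w :: "nat \<Rightarrow> real \<Rightarrow> real"
  assumes "CARD('d) \<ge> 2"
    and "q \<le> CARD('d) - 2"
    and "positively_oriented_basis \<xi>"
    and "configuration_enumeration \<xi> n conf"
    and "motion_reflection_invariant \<xi> n conf w"
    and "\<And>P. P \<in> full_polytopes \<Longrightarrow>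
           \<exists>l. ((\<lambda>a. mean_estimator \<xi> n conf w a P) \<longlongrightarrow> l) (at_right 0)"
  shows "(SUP P \<in> (full_polytopes :: (real ^ 'd) set set).
            ereal (\<bar>Lim (at_right 0) (\<lambda>a. mean_estimator \<xi> n conf w a P) - intrinsic_volume q P\<bar>
                   / intrinsic_volume q P)) \<ge> 1"
proof (rule ccontr)
  let ?N = "2 ^ (n ^ CARD('d)) - 1 :: nat"
  let ?mean = "\<lambda>a P. mean_estimator \<xi> n conf w a P"
  let ?p = "unit_parallelotope_volume"
  define \<kappa> where "\<kappa> = unit_ball_vol (real (CARD('d) - q))"
  have \<kappa>: "0 < \<kappa>" by (simp add: \<kappa>_def)
  assume "\<not> ?thesis"
  then have sup: "(SUP P \<in> (full_polytopes :: (real ^ 'd) set set).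
      ereal (\<bar>Lim (at_right 0) (\<lambda>a. ?mean a P) - intrinsic_volume q P\<bar> / intrinsic_volume q P)) < 1"
    by simp
  \<comment> \<open>On each polytope the bias is then strictly below \<open>100\<close> percent.\<close>
  have ratio: "\<bar>l - intrinsic_volume q P\<bar> / intrinsic_volume q P < 1"
    if "P \<in> full_polytopes" "((\<lambda>a. ?mean a P) \<longlongrightarrow> l) (at_right 0)" for P l
  proof -
    have "ereal (\<bar>Lim (at_right 0) (\<lambda>a. ?mean a P) - intrinsic_volume q P\<bar> / intrinsic_volume q P) < 1"
      using SUP_upper[OF that(1)] sup by (rule le_less_trans)
    then show ?thesis
      using tendsto_Lim[OF trivial_limit_at_right_real that(2)] by simp
  qed
  have "det (\<chi> i. \<xi> i) \<noteq> 0"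
    using assms(3) by (simp add: positively_oriented_basis_def)
  then obtain \<eta> where "dual_families \<xi> \<eta>" by (rule dual_families_exist)
  then have \<xi>: "dual_families \<eta> \<xi>"
    by (auto simp: dual_families_def inner_commute)
  \<comment> \<open>Inclusion-exclusion replaces configurations by the point sets \<open>B \<union> S\<close> that have to be hit.\<close>
  define K where "K = Sigma {1..?N} (\<lambda>l. Pow (snd (conf l)))"
  define T where "T = (\<lambda>(l, S). fst (conf l) \<union> S)"
  define \<gamma> where "\<gamma> a = (\<lambda>(l, S :: (real ^ 'd) set). w l a * (-1) ^ card S / ?p \<eta>)" for a
  let ?c = "width_coeff K \<gamma> T"
  have T: "T k \<subseteq> cell_points \<xi> n \<and> T k \<noteq> {}" if "k \<in> K" for k
    using that configuration_enumeration_facts[OF assms(4)] unfolding K_def T_def by fastforce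
  have mean: "\<forall>\<^sub>F a in at_right 0. ?mean a (parallelotope u H) = ?p u * (\<Sum>I\<in>UNIV. ?c I u a * (\<Prod>i\<in>I. H i))"
    if d: "dual_families u e" and H: "\<forall>i. 0 < H i" for u e H
  proof (rule eventually_mono)
    show "\<forall>\<^sub>F a in at_right 0. ?mean a (parallelotope u H) =
      (\<Sum>l = 1..?N. w l a * (\<Sum>S\<in>Pow (snd (conf l)). (-1) ^ card S *
         ((\<Prod>i\<in>UNIV. H i / a - width (fst (conf l) \<union> S) (u i)) * ?p u))) / ?p \<eta>"
      by (rule mean_estimator_parallelotope[OF \<xi> assms(4) d]) (simp add: H)
  next
    fix a
    assume elim: "?mean a (parallelotope u H) =
      (\<Sum>l = 1..?N. w l a * (\<Sum>S\<in>Pow (snd (conf l)). (-1) ^ card S *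
         ((\<Prod>i\<in>UNIV. H i / a - width (fst (conf l) \<union> S) (u i)) * ?p u))) / ?p \<eta>"
    have fin: "\<forall>l\<in>{1..?N}. finite (Pow (snd (conf l)))"
      using configuration_enumeration_facts(2)[OF assms(4)] finite_cell_points[of \<xi> n]
      by (metis finite_Pow_iff finite_Un)
    have "?mean a (parallelotope u H) =
        (\<Sum>l\<in>{1..?N}. \<Sum>S\<in>Pow (snd (conf l)). ?p u * (\<gamma> a (l, S) * (\<Prod>i\<in>UNIV. H i / a - width (T (l, S)) (u i))))"
      unfolding elim sum_divide_distrib sum_distrib_left \<gamma>_def T_def
      by (intro sum.cong refl) simp
    also have "\<dots> = (\<Sum>k\<in>K. ?p u * (\<gamma> a k * (\<Prod>i\<in>UNIV. H i / a - width (T k) (u i))))"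
      unfolding K_def by (subst sum.Sigma[OF _ fin]) (auto intro: sum.cong)
    also have "\<dots> = ?p u * (\<Sum>I\<in>UNIV. ?c I u a * (\<Prod>i\<in>I. H i))"
      unfolding sum_distrib_left[symmetric] width_coeff_expansion ..
    finally show "?mean a (parallelotope u H) = ?p u * (\<Sum>I\<in>UNIV. ?c I u a * (\<Prod>i\<in>I. H i))" .
  qed
  have q: "q \<le> CARD('d)" using assms(2) by simp
  have V_pos: "0 < intrinsic_volume q (parallelotope u H)" if d: "dual_families u e" and H: "\<forall>i. 0 < H i"
    for u e :: "'d \<Rightarrow> real ^ 'd" and H
  proof -
    obtain I :: "'d set" where "card I = q"
      using obtain_subset_with_card_n[OF q] by blast
    then have "{I :: 'd set. card I = q} \<noteq> {}" by blast
    then have "0 < (\<Sum>I | card I = q. zonotope_coeff e I * (\<Prod>i\<in>I. H i))"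
      by (intro sum_pos) (auto intro!: mult_pos_pos prod_pos zonotope_coeff_pos[OF d] H[rule_format])
    then show ?thesis
      unfolding parallelotope_intrinsic_volume[where H = H, OF d H[rule_format] q] \<kappa>_def[symmetric] using \<kappa> by simp
  qed
  \<comment> \<open>A relative bias below \<open>1\<close> keeps the limit strictly between \<open>0\<close> and twice the intrinsic volume.\<close>
  have limit: "\<exists>l. ((\<lambda>a. \<Sum>I\<in>UNIV. ?c I u a * (\<Prod>i\<in>I. H i)) \<longlongrightarrow> l) (at_right 0) \<and>
      0 < ?p u * l \<and> ?p u * l < 2 * intrinsic_volume q (parallelotope u H)"
    if d: "dual_families u e" and H: "\<forall>i. 0 < H i" for u e :: "'d \<Rightarrow> real ^ 'd" and H
  proof -
    let ?P = "parallelotope u H"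
    have p: "0 < ?p u" by (rule unit_parallelotope_volume_pos[OF d])
    have P: "?P \<in> full_polytopes" by (rule parallelotope_full[where H = H, OF d H[rule_format]])
    obtain l where l: "((\<lambda>a. ?mean a ?P) \<longlongrightarrow> l) (at_right 0)" using assms(6)[OF P] by blast
    have "((\<lambda>a. ?p u * (\<Sum>I\<in>UNIV. ?c I u a * (\<Prod>i\<in>I. H i))) \<longlongrightarrow> l) (at_right 0)"
      using tendsto_cong[OF mean[OF d H]] l by blast
    then have "((\<lambda>a. (1 / ?p u) * (?p u * (\<Sum>I\<in>UNIV. ?c I u a * (\<Prod>i\<in>I. H i)))) \<longlongrightarrow> (1 / ?p u) * l) (at_right 0)"
      by (rule tendsto_mult_left)
    then have "((\<lambda>a. \<Sum>I\<in>UNIV. ?c I u a * (\<Prod>i\<in>I. H i)) \<longlongrightarrow> (1 / ?p u) * l) (at_right 0)"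
      using p by simp
    moreover have "0 < l" "l < 2 * intrinsic_volume q ?P"
      using ratio[OF P l] V_pos[OF d H] by (auto simp: divide_less_eq abs_less_iff)
    ultimately show ?thesis using p by (intro exI[of _ "(1 / ?p u) * l"]) simp
  qed
  \<comment> \<open>Setting the coefficients at sets of other sizes to \<open>0\<close> makes the bound below force those of the estimator to vanish in the limit.\<close>
  define v where "v e I = (if card I = q then zonotope_coeff e I / \<kappa> else 0)" for e :: "'d \<Rightarrow> real ^ 'd" and I :: "'d set"
  have V: "intrinsic_volume q (parallelotope u H) = (\<Sum>I\<in>UNIV. v e I * (\<Prod>i\<in>I. H i))"
    if d: "dual_families u e" and H: "\<forall>i. 0 < H i" for u e :: "'d \<Rightarrow> real ^ 'd" and H
  proof -
    have "(\<Sum>I\<in>UNIV. v e I * (\<Prod>i\<in>I. H i)) = (\<Sum>I\<in>UNIV. if card I = q then zonotope_coeff e I * (\<Prod>i\<in>I. H i) / \<kappa> else 0)"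
      by (intro sum.cong refl) (simp add: v_def)
    also have "\<dots> = (\<Sum>I | card I = q. zonotope_coeff e I * (\<Prod>i\<in>I. H i) / \<kappa>)"
      by (subst sum.inter_filter[symmetric]) auto
    finally show ?thesis
      by (simp add: parallelotope_intrinsic_volume[where H = H, OF d H[rule_format] q] \<kappa>_def sum_divide_distrib)
  qed
  have coeff: "\<exists>\<alpha>. (?c I u \<longlongrightarrow> \<alpha>) (at_right 0) \<and> \<bar>?p u * \<alpha>\<bar> \<le> 2 * v e I"
    if d: "dual_families u e" for u e :: "'d \<Rightarrow> real ^ 'd" and I
  proof -
    have "\<exists>l. ((\<lambda>a. ?c J u a) \<longlongrightarrow> l) (at_right 0)" for J
    proof (rule multiaffine_tendsto_coeffs[where A = "\<lambda>a J. ?c J u a" and F = UNIV and I = J])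
      show "\<exists>l. ((\<lambda>a. \<Sum>I\<in>Pow UNIV. ?c I u a * (\<Prod>i\<in>I. H i)) \<longlongrightarrow> l) (at_right 0)" if "\<And>i. 0 < H i" for H
        using limit[OF d, of H] that unfolding Pow_UNIV by blast
    qed auto
    then obtain \<alpha> where \<alpha>: "\<And>J. (?c J u \<longlongrightarrow> \<alpha> J) (at_right 0)" by metis
    have bound: "\<bar>\<Sum>J\<in>UNIV. ?p u * \<alpha> J * (\<Prod>i\<in>J. H i)\<bar> \<le> (\<Sum>J\<in>UNIV. 2 * v e J * (\<Prod>i\<in>J. H i))"
      if H: "\<forall>i. 0 < H i" for H
    proof -
      obtain l where l: "((\<lambda>a. \<Sum>I\<in>UNIV. ?c I u a * (\<Prod>i\<in>I. H i)) \<longlongrightarrow> l) (at_right 0)"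
        "0 < ?p u * l" "?p u * l < 2 * intrinsic_volume q (parallelotope u H)"
        using limit[OF d H] by blast
      have "((\<lambda>a. \<Sum>I\<in>UNIV. ?c I u a * (\<Prod>i\<in>I. H i)) \<longlongrightarrow> (\<Sum>I\<in>UNIV. \<alpha> I * (\<Prod>i\<in>I. H i))) (at_right 0)"
        by (intro tendsto_sum tendsto_mult_right \<alpha>)
      then have "l = (\<Sum>I\<in>UNIV. \<alpha> I * (\<Prod>i\<in>I. H i))"
        by (rule tendsto_unique[OF trivial_limit_at_right_real l(1)])
      then have "?p u * l = (\<Sum>J\<in>UNIV. ?p u * \<alpha> J * (\<Prod>i\<in>J. H i))"
        by (simp add: sum_distrib_left mult.assoc)
      moreover have "2 * intrinsic_volume q (parallelotope u H) = (\<Sum>J\<in>UNIV. 2 * v e J * (\<Prod>i\<in>J. H i))"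
        by (simp add: V[OF d H] sum_distrib_left mult.assoc)
      ultimately show ?thesis using l(2,3) by simp
    qed
    have "0 \<le> 2 * v e I - ?p u * \<alpha> I"
    proof (rule multiaffine_nonneg_coeffs[where F = UNIV and c = "\<lambda>J. 2 * v e J - ?p u * \<alpha> J"])
      show "0 \<le> (\<Sum>J\<in>Pow UNIV. (2 * v e J - ?p u * \<alpha> J) * (\<Prod>i\<in>J. H i))" if "\<And>i. 0 < H i" for H
        using bound[of H] that unfolding Pow_UNIV left_diff_distrib sum_subtractf abs_le_iff by (simp add: le_diff_eq)
    qed auto
    moreover have "0 \<le> 2 * v e I + ?p u * \<alpha> I"
    proof (rule multiaffine_nonneg_coeffs[where F = UNIV and c = "\<lambda>J. 2 * v e J + ?p u * \<alpha> J"])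
      show "0 \<le> (\<Sum>J\<in>Pow UNIV. (2 * v e J + ?p u * \<alpha> J) * (\<Prod>i\<in>J. H i))" if "\<And>i. 0 < H i" for H
        using bound[of H] that unfolding Pow_UNIV distrib_right sum.distrib abs_le_iff by (simp add: sum_negf)
    qed auto
    ultimately show ?thesis using \<alpha>[of I] by (intro exI[of _ "\<alpha> I"]) (simp add: abs_le_iff)
  qed
  obtain U and u e :: "'d \<Rightarrow> real ^ 'd" where U: "width_cone U K T" and d: "dual_families u e" and uU: "\<And>i. u i \<in> U"
    using width_cone_exists[OF finite_cell_points[of \<xi> n], of K T] T by metis
  have zero: "(?c I u \<longlongrightarrow> 0) (at_right 0)" for I
  proof (cases "card I = q")
    case False
    obtain \<alpha> where "(?c I u \<longlongrightarrow> \<alpha>) (at_right 0)" "\<bar>?p u * \<alpha>\<bar> \<le> 2 * v e I"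
      using coeff[OF d] by blast
    then show ?thesis
      using False unit_parallelotope_volume_pos[OF d] by (simp add: v_def)
  next
    case True
    have "card (- I) = CARD('d) - q"
      using True by (simp add: Compl_eq_Diff_UNIV card_Diff_subset)
    then have "2 \<le> card (- I)" using assms(1,2) by linarith
    then obtain J where J: "J \<subseteq> - I" "card J = 2"
      by (rule obtain_subset_with_card_n)
    then obtain i j where ij: "i \<notin> I" "j \<notin> I" "i \<noteq> j"
      by (auto simp: card_2_iff)
    show ?thesis
    proof (rule width_cone.coefficient_vanishes[OF U _ d uU ij, where M = "2 / \<kappa>"])
      show "\<exists>\<alpha>. (?c I u \<longlongrightarrow> \<alpha>) (at_right 0) \<and> \<bar>?p u * \<alpha>\<bar> \<le> 2 / \<kappa> * zonotope_coeff e I"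
        if "dual_families u e" for u e
        using coeff[OF that, of I] True by (simp add: v_def)
    qed
  qed
  \<comment> \<open>With all coefficients tending to \<open>0\<close>, the estimator tends to \<open>0\<close> on the unit parallelotope with normals \<open>u\<close>.\<close>
  obtain l where l: "((\<lambda>a. \<Sum>I\<in>UNIV. ?c I u a * (\<Prod>i\<in>I. 1)) \<longlongrightarrow> l) (at_right 0)" "0 < ?p u * l"
    using limit[OF d, of "\<lambda>_. 1"] by auto
  have "((\<lambda>a. \<Sum>I\<in>UNIV. ?c I u a * (\<Prod>i\<in>I. 1)) \<longlongrightarrow> (\<Sum>I\<in>(UNIV :: 'd set set). 0 * (\<Prod>i\<in>I. 1))) (at_right 0)"
    by (intro tendsto_sum tendsto_mult_right zero)
  then have "l = (\<Sum>I\<in>(UNIV :: 'd set set). 0 * (\<Prod>i\<in>I. 1))"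
    by (rule tendsto_unique[OF trivial_limit_at_right_real l(1)])
  with l(2) show False by simp
qed

end
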